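(* Let $(g,\theta)$ be a conformally flat LCP structure on a unimodular Lie algebra $\mathfrak g$. Then $\mathfrak g$ is isomorphic to one of the Lie algebras $\mathbb R$, $\mathbb R^2$, $\mathfrak{su}(2)\oplus\mathbb R$, and the LCP structure is as follows. If $\mathfrak g=\mathbb R^p$ with $p\in\{1,2\}$, then $g$ is an inner product and $\theta$ a non-zero 1-form on $\mathbb R^p$. If $\mathfrak g=\mathfrak{su}(2)\oplus\mathbb R$, fix an element $z$ spanning the center of $\mathfrak g$ and let $\kappa$ be the Killing form of $\mathfrak{su}(2)$; then there exist $\mu>0$, $\lambda\in\mathbb R\setminus\{0\}$ and $x_0\in\mathfrak{su}(2)$ such that $g|_{\mathfrak{su}(2)}=-\mu\kappa$, $g(z,x)=\frac{\mu}{\lambda}\kappa(x_0,x)$ for all $x\in\mathfrak{su}(2)$, $g(z,z)=\frac{1}{\lambda^2}\big(\frac1{8\mu}-\mu\kappa(x_0,x_0)\big)$, and $\theta=g(\lambda z+x_0,\cdot)$. In particular, in the last case the metric $g|_{\mathfrak{su}(2)}$ is a multiple of the Killing form.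
   Context: All Lie algebras are real and finite-dimensional. Let $\mathfrak g$ be a Lie algebra with an inner product $g$. For $x\in\mathfrak g$, $\nabla^g_x\in\mathfrak{so}(\mathfrak g)$ is given by $g(\nabla^g_xy,z)=\frac12\big(g([x,y],z)-g([x,z],y)-g([y,z],x)\big)$. For $\theta\in\mathfrak g^*$ with $g$-dual vector $\theta^\sharp$, set $\nabla^\theta_xy:=\nabla^g_xy+\theta(x)y+\theta(y)x-g(x,y)\theta^\sharp$. A 1-form $\theta\in\mathfrak g^*$ is closed if it vanishes on $\mathfrak g'=[\mathfrak g,\mathfrak g]$. A subspace $\mathfrak u\subset\mathfrak g$ is $\nabla^\theta$-flat if $\nabla^\theta_x\mathfrak u\subset\mathfrak u$ for all $x\in\mathfrak g$ and $x\mapsto\nabla^\theta_x|_{\mathfrak u}$ is a Lie algebra representation $\mathfrak g\to\mathfrak{gl}(\mathfrak u)$. An LCP structure on $\mathfrak g$ is a triple $(g,\theta,\mathfrak u)$ with $g$ an inner product, $\theta\ne0$ a closed 1-form and $\mathfrak u\neq0$ a $\nabla^\theta$-flat subspace. It is conformally flat if $\mathfrak u=\mathfrak g$, and then it is denoted $(g,\theta)$. A Lie algebra $\mathfrak g$ is unimodular if $\mathrm{tr}(\mathrm{ad}_x)=0$ for all $x\in\mathfrak g$. *)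

theory Defs
  imports "HOL-Analysis.Analysis"
begin

text \<open>
  A real Lie algebra is a finite-dimensional linear subspace \<open>V\<close> of some real vector space together
  with a bracket \<open>br\<close>. Brackets, forms and maps are total functions, but only their values on \<open>V\<close>
  are ever constrained or used.
\<close>

definition linear_between ::
    "'a::real_vector set \<Rightarrow> 'b::real_vector set \<Rightarrow> ('a \<Rightarrow> 'b) \<Rightarrow> bool" where
  "linear_between V W f \<longleftrightarrow>
     (\<forall>x\<in>V. f x \<in> W) \<and>
     (\<forall>x\<in>V. \<forall>y\<in>V. f (x + y) = f x + f y) \<and>
     (\<forall>c. \<forall>x\<in>V. f (c *\<^sub>R x) = c *\<^sub>R f x)"

definition bilinear_between ::
    "'a::real_vector set \<Rightarrow> 'b::real_vector set \<Rightarrow> ('a \<Rightarrow> 'a \<Rightarrow> 'b) \<Rightarrow> bool" where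
  "bilinear_between V W h \<longleftrightarrow>
     (\<forall>x\<in>V. linear_between V W (h x)) \<and> (\<forall>y\<in>V. linear_between V W (\<lambda>x. h x y))"

definition lie_algebra :: "'a::real_vector set \<Rightarrow> ('a \<Rightarrow> 'a \<Rightarrow> 'a) \<Rightarrow> bool" where
  "lie_algebra V br \<longleftrightarrow>
     subspace V \<and> (\<exists>B. finite B \<and> span B = V) \<and>
     bilinear_between V V br \<and>
     (\<forall>x\<in>V. br x x = 0) \<and>
     (\<forall>x\<in>V. \<forall>y\<in>V. \<forall>z\<in>V. br x (br y z) + br y (br z x) + br z (br x y) = 0)"

definition lie_isomorphism ::
    "'a::real_vector set \<Rightarrow> ('a \<Rightarrow> 'a \<Rightarrow> 'a) \<Rightarrow>
     'b::real_vector set \<Rightarrow> ('b \<Rightarrow> 'b \<Rightarrow> 'b) \<Rightarrow> ('a \<Rightarrow> 'b) \<Rightarrow> bool" where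
  "lie_isomorphism V br W br' f \<longleftrightarrow>
     linear_between V W f \<and> bij_betw f V W \<and>
     (\<forall>x\<in>V. \<forall>y\<in>V. f (br x y) = br' (f x) (f y))"

definition lie_isomorphic ::
    "'a::real_vector set \<Rightarrow> ('a \<Rightarrow> 'a \<Rightarrow> 'a) \<Rightarrow>
     'b::real_vector set \<Rightarrow> ('b \<Rightarrow> 'b \<Rightarrow> 'b) \<Rightarrow> bool" where
  "lie_isomorphic V br W br' \<longleftrightarrow> (\<exists>f. lie_isomorphism V br W br' f)"

definition derived_algebra :: "'a::real_vector set \<Rightarrow> ('a \<Rightarrow> 'a \<Rightarrow> 'a) \<Rightarrow> 'a set" where
  "derived_algebra V br = span {br x y |x y. x \<in> V \<and> y \<in> V}"

definition lie_center :: "'a::real_vector set \<Rightarrow> ('a \<Rightarrow> 'a \<Rightarrow> 'a) \<Rightarrow> 'a set" where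
  "lie_center V br = {z \<in> V. \<forall>x\<in>V. br z x = 0}"

text \<open>The trace of an endomorphism \<open>f\<close> of \<open>V\<close>, computed in some basis of \<open>V\<close>; the value does not
  depend on the basis.\<close>

definition endo_trace :: "'a::real_vector set \<Rightarrow> ('a \<Rightarrow> 'a) \<Rightarrow> real" where
  "endo_trace V f =
     (let B = (SOME B. independent B \<and> span B = V) in \<Sum>b\<in>B. representation B (f b) b)"

definition unimodular :: "'a::real_vector set \<Rightarrow> ('a \<Rightarrow> 'a \<Rightarrow> 'a) \<Rightarrow> bool" where
  "unimodular V br \<longleftrightarrow> (\<forall>x\<in>V. endo_trace V (br x) = 0)"

definition killing_form :: "'a::real_vector set \<Rightarrow> ('a \<Rightarrow> 'a \<Rightarrow> 'a) \<Rightarrow> 'a \<Rightarrow> 'a \<Rightarrow> real" where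
  "killing_form V br x y = endo_trace V (br x \<circ> br y)"

definition lie_representation ::
    "'a::real_vector set \<Rightarrow> ('a \<Rightarrow> 'a \<Rightarrow> 'a) \<Rightarrow> 'b::real_vector set \<Rightarrow> ('a \<Rightarrow> 'b \<Rightarrow> 'b) \<Rightarrow> bool" where
  "lie_representation V br U \<rho> \<longleftrightarrow>
     (\<forall>x\<in>V. linear_between U U (\<rho> x)) \<and>
     (\<forall>u\<in>U. linear_between V U (\<lambda>x. \<rho> x u)) \<and>
     (\<forall>x\<in>V. \<forall>y\<in>V. \<forall>u\<in>U. \<rho> (br x y) u = \<rho> x (\<rho> y u) - \<rho> y (\<rho> x u))"

definition inner_product_on :: "'a::real_vector set \<Rightarrow> ('a \<Rightarrow> 'a \<Rightarrow> real) \<Rightarrow> bool" where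
  "inner_product_on V g \<longleftrightarrow>
     bilinear_between V UNIV g \<and>
     (\<forall>x\<in>V. \<forall>y\<in>V. g x y = g y x) \<and>
     (\<forall>x\<in>V. x \<noteq> 0 \<longrightarrow> g x x > 0)"

definition nonzero_one_form :: "'a::real_vector set \<Rightarrow> ('a \<Rightarrow> real) \<Rightarrow> bool" where
  "nonzero_one_form V \<theta> \<longleftrightarrow> linear_between V UNIV \<theta> \<and> (\<exists>x\<in>V. \<theta> x \<noteq> 0)"

definition closed_form :: "'a::real_vector set \<Rightarrow> ('a \<Rightarrow> 'a \<Rightarrow> 'a) \<Rightarrow> ('a \<Rightarrow> real) \<Rightarrow> bool" where
  "closed_form V br \<theta> \<longleftrightarrow> (\<forall>x\<in>derived_algebra V br. \<theta> x = 0)"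

text \<open>The vector \<open>\<theta>\<^sup>\<sharp>\<close>. This and the next description are well defined because \<open>g\<close> is an inner
  product on the finite-dimensional space \<open>V\<close>.\<close>

definition sharp :: "'a::real_vector set \<Rightarrow> ('a \<Rightarrow> 'a \<Rightarrow> real) \<Rightarrow> ('a \<Rightarrow> real) \<Rightarrow> 'a" where
  "sharp V g \<theta> = (THE w. w \<in> V \<and> (\<forall>z\<in>V. g w z = \<theta> z))"

definition levi_civita ::
    "'a::real_vector set \<Rightarrow> ('a \<Rightarrow> 'a \<Rightarrow> 'a) \<Rightarrow> ('a \<Rightarrow> 'a \<Rightarrow> real) \<Rightarrow> 'a \<Rightarrow> 'a \<Rightarrow> 'a" where
  "levi_civita V br g x y =
     (THE w. w \<in> V \<and>
        (\<forall>z\<in>V. g w z = (1/2) * (g (br x y) z - g (br x z) y - g (br y z) x)))"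

definition weyl_connection ::
    "'a::real_vector set \<Rightarrow> ('a \<Rightarrow> 'a \<Rightarrow> 'a) \<Rightarrow> ('a \<Rightarrow> 'a \<Rightarrow> real) \<Rightarrow> ('a \<Rightarrow> real) \<Rightarrow> 'a \<Rightarrow> 'a \<Rightarrow> 'a" where
  "weyl_connection V br g \<theta> x y =
     levi_civita V br g x y + \<theta> x *\<^sub>R y + \<theta> y *\<^sub>R x - g x y *\<^sub>R sharp V g \<theta>"

text \<open>Invariance of \<open>U\<close> under all \<open>\<nabla>\<^sup>\<theta>\<^sub>x\<close> is part of being a representation on \<open>U\<close>.\<close>

definition weyl_flat ::
    "'a::real_vector set \<Rightarrow> ('a \<Rightarrow> 'a \<Rightarrow> 'a) \<Rightarrow> ('a \<Rightarrow> 'a \<Rightarrow> real) \<Rightarrow> ('a \<Rightarrow> real) \<Rightarrow> 'a set \<Rightarrow> bool" where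
  "weyl_flat V br g \<theta> U \<longleftrightarrow>
     subspace U \<and> U \<subseteq> V \<and> lie_representation V br U (weyl_connection V br g \<theta>)"

definition lcp_structure ::
    "'a::real_vector set \<Rightarrow> ('a \<Rightarrow> 'a \<Rightarrow> 'a) \<Rightarrow> ('a \<Rightarrow> 'a \<Rightarrow> real) \<Rightarrow> ('a \<Rightarrow> real) \<Rightarrow> 'a set \<Rightarrow> bool" where
  "lcp_structure V br g \<theta> U \<longleftrightarrow>
     inner_product_on V g \<and> nonzero_one_form V \<theta> \<and> closed_form V br \<theta> \<and>
     U \<noteq> {0} \<and> weyl_flat V br g \<theta> U"

definition conformally_flat_lcp ::
    "'a::real_vector set \<Rightarrow> ('a \<Rightarrow> 'a \<Rightarrow> 'a) \<Rightarrow> ('a \<Rightarrow> 'a \<Rightarrow> real) \<Rightarrow> ('a \<Rightarrow> real) \<Rightarrow> bool" where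
  "conformally_flat_lcp V br g \<theta> \<longleftrightarrow> lcp_structure V br g \<theta> V"

definition abelian_bracket :: "'a::real_vector \<Rightarrow> 'a \<Rightarrow> 'a" where
  "abelian_bracket x y = 0"

definition su2 :: "(complex^2^2) set" where
  "su2 = {A. (\<forall>i j. A $ j $ i = - cnj (A $ i $ j)) \<and> trace A = 0}"

definition commutator :: "complex^2^2 \<Rightarrow> complex^2^2 \<Rightarrow> complex^2^2" where
  "commutator A B = A ** B - B ** A"

definition sum_bracket ::
    "('a \<Rightarrow> 'a \<Rightarrow> 'a) \<Rightarrow> ('b \<Rightarrow> 'b \<Rightarrow> 'b) \<Rightarrow> 'a \<times> 'b \<Rightarrow> 'a \<times> 'b \<Rightarrow> 'a \<times> 'b" where
  "sum_bracket br br' p q = (br (fst p) (fst q), br' (snd p) (snd q))"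

definition su2_R :: "((complex^2^2) \<times> real) set" where
  "su2_R = su2 \<times> UNIV"

definition su2_R_bracket ::
    "(complex^2^2) \<times> real \<Rightarrow> (complex^2^2) \<times> real \<Rightarrow> (complex^2^2) \<times> real" where
  "su2_R_bracket = sum_bracket commutator abelian_bracket"

end

theory Submission
  imports Defs "Jordan_Normal_Form.Char_Poly"
begin

text \<open>
  Let \<open>D\<close> be the Weyl connection, \<open>t = \<theta>\<^sup>\<sharp>\<close>, \<open>c = |t|\<^sup>2\<close>, and \<open>H = ker \<theta>\<close>, an ideal containing all brackets.
  Flatness and unimodularity force \<open>D x t = c x\<close>, and a comparison of characteristic polynomials then
  shows that \<open>D x v = 0\<close> only if \<open>x = 0\<close> or \<open>v = 0\<close>. The elements of \<open>H\<close> act by skew maps, so minus the trace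
  form of \<open>D\<close> is an invariant inner product on \<open>H\<close>, and commuting elements of \<open>H\<close> are proportional. A Lie
  algebra with these two properties is \<open>0\<close>, a line, or \<open>su(2)\<close>. In the last case the metric on
  \<open>H\<close> is diagonalised by a standard triple of \<open>su(2)\<close>, and Milnor's curvature formulas show that all three
  eigenvalues equal \<open>1 / (4 c)\<close>. Finally \<open>t\<close> acts on \<open>H\<close> by a skew derivation, which is inner, so \<open>t\<close> is the sum
  of a central element and an element of \<open>H\<close>.
\<close>

subsection \<open>Linear algebra\<close>

text \<open>Write \<open>R v\<close> for the map taking \<open>x\<close> to \<open>D x v\<close>.
  Unimodularity enters through traces: \<open>D x\<close> is \<open>g t x\<close> times the identity
  plus a skew map, so a traceless \<open>ad x\<close> forces \<open>R x\<close> to have trace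
  \<open>n * g t x\<close>. The obstacle is to exclude \<open>D x v = 0\<close> for nonzero
  \<open>x\<close> and \<open>v\<close>; both the positivity of the trace form and the
  proportionality of commuting elements depend on it. The traced flatness identity yields a
  logarithmic derivative: for \<open>w\<close> in \<open>H\<close> the characteristic polynomial
  \<open>p\<close> of \<open>R w\<close> satisfies \<open>p' / p = n l / (l^2 + c |w|^2)\<close>.
  The right-hand side has no real pole, so \<open>p\<close> has no real root. The constants come
  from curvature. Elements of \<open>H\<close> act by skew maps and \<open>D x t = c x\<close>, so
  \<open>H\<close> behaves like a totally umbilic hypersurface with normal \<open>t\<close> of
  length \<open>sqrt c\<close> in a flat space: flatness of \<open>D\<close> becomes constant
  sectional curvature \<open>c\<close> on \<open>H\<close>. A standard triple that is orthogonal
  with common square length \<open>a\<close> has curvature \<open>1 / (4 a)\<close>, whence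
  \<open>a = 1 / (4 c)\<close>. The Killing form takes the value -2 on each member of such a triple,
  whence \<open>\<mu> = 1 / (8 c)\<close>.\<close>

lemma char_poly_adjugate:
  fixes a :: "nat \<Rightarrow> nat \<Rightarrow> real"
  shows "\<exists>(p :: real poly) B. p \<noteq> 0 \<and>
    (\<forall>l. \<forall>i<n. \<forall>j<n. (\<Sum>k<n. ((if i = k then l else 0) - a i k) * poly (B k j) l) = (if i = j then poly p l else 0)) \<and>
    (\<forall>l. \<forall>i<n. \<forall>j<n. (\<Sum>k<n. poly (B i k) l * ((if k = j then l else 0) - a k j)) = (if i = j then poly p l else 0)) \<and>
    (\<Sum>i<n. B i i) = pderiv p"
proof -
  define A where "A = Matrix.mat n n (\<lambda>(i, j). a i j)"
  define C where "C = char_poly_matrix A"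
  \<comment> \<open>The adjugate of \<open>l I - A\<close>, with entries polynomial in
    \<open>l\<close>, so that it makes sense at eigenvalues too.\<close>
  define B where "B i j = adj_mat C $$ (i, j)" for i j
  have A: "A \<in> carrier_mat n n" by (simp add: A_def)
  then have C: "C \<in> carrier_mat n n" by (simp add: C_def)
  note adj = adj_mat[OF C]
  have p: "Determinant.det C = char_poly A" by (simp add: C_def char_poly_def)
  have Cij: "C $$ (i, j) = [:- a i j, if i = j then 1 else 0:]" if "i < n" "j < n" for i j
    using that by (simp add: C_def char_poly_matrix_def A_def)
  have Cl: "poly (C $$ (i, j)) l = (if i = j then l else 0) - a i j" if "i < n" "j < n" for i j l
    using that by (simp add: Cij)
  show ?thesis
  proof (intro exI[of _ "char_poly A"] exI[of _ B] conjI allI impI)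
    show "char_poly A \<noteq> 0"
      using degree_monic_char_poly[OF A] by auto
  next
    fix l i j assume ij: "i < n" "j < n"
    have "(C * adj_mat C) $$ (i, j) = (\<Sum>k<n. C $$ (i, k) * B k j)"
      using ij C adj(1) by (simp add: scalar_prod_def B_def lessThan_atLeast0)
    then have "(\<Sum>k<n. C $$ (i, k) * B k j) = (if i = j then char_poly A else 0)"
      using adj(2) ij p by (auto split: if_splits)
    then have "poly (\<Sum>k<n. C $$ (i, k) * B k j) l = poly (if i = j then char_poly A else 0) l"
      by simp
    then show "(\<Sum>k<n. ((if i = k then l else 0) - a i k) * poly (B k j) l)
        = (if i = j then poly (char_poly A) l else 0)"
      using ij by (simp add: poly_sum Cl split: if_splits)
  next
    fix l i j assume ij: "i < n" "j < n"
    have "(adj_mat C * C) $$ (i, j) = (\<Sum>k<n. B i k * C $$ (k, j))"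
      using ij C adj(1) by (simp add: scalar_prod_def B_def lessThan_atLeast0)
    then have "(\<Sum>k<n. B i k * C $$ (k, j)) = (if i = j then char_poly A else 0)"
      using adj(3) ij p by (auto split: if_splits)
    then have "poly (\<Sum>k<n. B i k * C $$ (k, j)) l = poly (if i = j then char_poly A else 0) l"
      by simp
    then show "(\<Sum>k<n. poly (B i k) l * ((if k = j then l else 0) - a k j))
        = (if i = j then poly (char_poly A) l else 0)"
      using ij by (simp add: poly_sum Cl split: if_splits)
  next
    \<comment> \<open>Diagonal cofactors are the characteristic polynomials of the principal
      submatrices; these add up to the derivative.\<close>
    have "B i i = char_poly (mat_delete A i i)" if "i < n" for i
    proof -
      have "mat_delete C i i = char_poly_matrix (mat_delete A i i)"
        using A that unfolding C_def char_poly_matrix_def mat_delete_def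
        by (intro eq_matI) auto
      then show ?thesis
        using that C by (simp add: B_def adj_mat_def cofactor_def char_poly_def)
    qed
    then show "(\<Sum>i<n. B i i) = pderiv (char_poly A)"
      by (simp add: pderiv_char_poly[OF A])
  qed
qed

text \<open>Comparing the multiplicities of a real root on both sides excludes it.\<close>

lemma no_real_root_if_log_derivative:
  fixes p :: "real poly"
  assumes "p \<noteq> 0" "a > 0" "r \<noteq> 0"
    and eq: "\<And>l. poly p l \<noteq> 0 \<Longrightarrow> poly (pderiv p) l * (l\<^sup>2 + a) = r * l * poly p l"
  shows "poly p l \<noteq> 0"
proof
  assume root: "poly p l = 0"
  define q where "q = [:a, 0, 1:]"
  have q: "poly q l = l\<^sup>2 + a" for l by (simp add: q_def power2_eq_square)
  have q0: "q \<noteq> 0" by (simp add: q_def)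
  define P where "P = pderiv p * q - [:0, r:] * p"
  \<comment> \<open>The hypothesis speaks only of points off the zeros of \<open>p\<close>; the
    factor \<open>p\<close> covers the zeros, and is cancelled afterwards in the integral domain of
    polynomials.\<close>
  have "P * p = 0"
  proof -
    have "poly (P * p) l = 0" for l
      using eq[of l] by (cases "poly p l = 0") (auto simp: P_def q)
    then show ?thesis
      by (metis poly_0 poly_eq_poly_eq_iff ext)
  qed
  then have eqp: "pderiv p * q = [:0, r:] * p"
    using \<open>p \<noteq> 0\<close> by (simp add: P_def)
  have dp: "pderiv p \<noteq> 0"
    using root \<open>p \<noteq> 0\<close> by (metis degree_eq_zeroE pderiv_eq_0_iff poly_const_conv pCons_0_0)
  have "order l q = 0"
    using \<open>a > 0\<close> by (intro order_0I) (simp add: q add_nonneg_pos less_imp_neq[symmetric])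
  moreover have "order l (pderiv p * q) = order l (pderiv p) + order l q"
    using dp q0 by (intro order_mult) simp
  moreover have "order l ([:0, r:] * p) = order l [:0, r:] + order l p"
    using \<open>p \<noteq> 0\<close> \<open>r \<noteq> 0\<close> by (intro order_mult) simp
  moreover have "order l p = Suc (order l (pderiv p))"
    using dp root \<open>p \<noteq> 0\<close> by (intro order_pderiv) (auto simp: order_root)
  ultimately show False using eqp by simp
qed

section \<open>Orthonormal bases and least eigenvectors of bilinear forms\<close>

lemmas bilinear_simps =
  bilinear_ladd bilinear_radd bilinear_lmul bilinear_rmul bilinear_lneg bilinear_rneg
  bilinear_lsub bilinear_rsub bilinear_lzero bilinear_rzero

lemma bilinear_lsum: "bilinear h \<Longrightarrow> h (sum f A) y = (\<Sum>i\<in>A. h (f i) y)"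
  using linear_sum[of "\<lambda>x. h x y" f A] by (simp add: bilinear_def)

lemma bilinear_rsum: "bilinear h \<Longrightarrow> h y (sum f A) = (\<Sum>i\<in>A. h y (f i))"
  using linear_sum[of "h y" f A] by (simp add: bilinear_def)

text \<open>Gram-Schmidt, adding one generator at a time: its component orthogonal to the earlier
  frame is either zero, and the frame stays, or is normalised and appended.\<close>

lemma orthonormal_basis_exists:
  fixes g :: "'a::real_vector \<Rightarrow> 'a \<Rightarrow> real"
  assumes "finite B" and bil: "bilinear g" and sym: "\<And>x y. g x y = g y x"
    and pos: "\<And>x. x \<in> span B \<Longrightarrow> x \<noteq> 0 \<Longrightarrow> g x x > 0"
  shows "\<exists>(n::nat) e. (\<forall>i<n. e i \<in> span B) \<and>
     (\<forall>i<n. \<forall>j<n. g (e i) (e j) = (if i = j then 1 else 0)) \<and>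
     (\<forall>x\<in>span B. x = (\<Sum>i<n. g x (e i) *\<^sub>R e i))"
  using \<open>finite B\<close> pos
proof (induction B rule: finite_induct)
  case empty
  then show ?case by (intro exI[of _ 0]) auto
next
  case (insert b B)
  note bs = bilinear_simps[OF bil]
  have sub: "span B \<subseteq> span (insert b B)" by (rule span_mono) auto
  then obtain n e where e: "\<And>i. i < n \<Longrightarrow> e i \<in> span B"
    and o: "\<And>i j. i < n \<Longrightarrow> j < n \<Longrightarrow> g (e i) (e j) = (if i = j then 1 else 0)"
    and ex: "\<And>x. x \<in> span B \<Longrightarrow> x = (\<Sum>i<(n::nat). g x (e i) *\<^sub>R e i)"
    using insert.IH insert.prems by (smt (verit, ccfv_SIG) subset_iff)
  define s where "s = (\<Sum>i<n. g b (e i) *\<^sub>R e i)"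
  define w where "w = b - s"
  have s: "s \<in> span B" unfolding s_def by (intro span_sum span_scale e) auto
  have we: "g w (e j) = 0" if "j < n" for j
  proof -
    have "g s (e j) = (\<Sum>i<n. g b (e i) * (if i = j then 1 else 0))"
      unfolding s_def bilinear_lsum[OF bil] using that by (intro sum.cong) (auto simp: bs o)
    then show ?thesis using that by (simp add: w_def bs mult_delta_right)
  qed
  have wB: "w \<in> span (insert b B)"
    unfolding w_def using s sub by (intro span_diff) (auto intro: span_base)
  show ?case
  proof (cases "w = 0")
    case True
    then have "b \<in> span B" using s by (simp add: w_def)
    then have "span (insert b B) = span B" by (rule span_redundant)
    then show ?thesis using e o ex by (intro exI[of _ n] exI[of _ e]) auto
  next
    case False
    with wB insert.prems have w0: "g w w > 0" by blast
    define f where "f i = (if i = n then (1 / sqrt (g w w)) *\<^sub>R w else e i)" for i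
    have f1: "f i \<in> span (insert b B)" if "i < Suc n" for i
      using that e sub wB by (auto simp: f_def less_Suc_eq intro: span_scale)
    have f2: "g (f i) (f j) = (if i = j then 1 else 0)" if "i < Suc n" "j < Suc n" for i j
      using that w0 o we sym[of "e i" w] by (auto simp: f_def less_Suc_eq bs)
    have "x = (\<Sum>i<Suc n. g x (f i) *\<^sub>R f i)" if "x \<in> span (insert b B)" for x
    proof -
      from that obtain k where "x - k *\<^sub>R b \<in> span B"
        using span_breakdown_eq by blast
      then have "x - k *\<^sub>R b + k *\<^sub>R s \<in> span B" using s by (intro span_add span_scale)
      then obtain y where y: "y \<in> span B" "x = k *\<^sub>R w + y"
        by (metis (no_types, lifting) add_diff_cancel_left' diff_add_cancel diff_diff_eq2
            scaleR_right_diff_distrib w_def add.commute)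
      have yw: "g y w = 0"
        using we by (subst ex[OF y(1)]) (simp add: bilinear_rsum[OF bil] bilinear_lsum[OF bil] bs sym[of _ w])
      have "(\<Sum>i<n. g x (f i) *\<^sub>R f i) = (\<Sum>i<n. g y (e i) *\<^sub>R e i)"
        by (intro sum.cong) (auto simp: f_def y bs we)
      also have "\<dots> = y" by (rule ex[OF y(1), symmetric])
      finally have "(\<Sum>i<n. g x (f i) *\<^sub>R f i) = y" .
      moreover have "g x (f n) *\<^sub>R f n = k *\<^sub>R w"
        using w0 by (simp add: f_def y bs yw)
      ultimately show ?thesis by (simp add: y)
    qed
    then show ?thesis using f1 f2 by (intro exI[of _ "Suc n"] exI[of _ f]) auto
  qed
qed

text \<open>By Tychonoff. Minimisation takes place in coordinate space because the ambient type
  carries no topology, and functions on \<open>nat\<close> allow the dimension \<open>n\<close> to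
  be a variable.\<close>

lemma compact_real_fun_box: "compact {a :: nat \<Rightarrow> real. \<forall>i. a i \<in> {-1..1}}"
proof -
  have "compactin (product_topology (\<lambda>i. euclidean) UNIV) (PiE UNIV (\<lambda>i::nat. {-1..1::real}))"
    by (subst compactin_PiE) simp
  then show ?thesis
    by (simp add: euclidean_product_topology PiE_UNIV_domain Pi_def)
qed

text \<open>Minimise the Rayleigh quotient of \<open>q\<close> relative to \<open>\<beta>\<close>
  over the unit sphere of \<open>E\<close>. The eigenvalue equation is stated in weak form, tested
  against \<open>E\<close> only, which leaves open whether an underlying operator preserves
  \<open>E\<close>.\<close>

lemma least_eigenvector:
  fixes \<beta> q :: "'a::real_vector \<Rightarrow> 'a \<Rightarrow> real"
  assumes E: "subspace E" "finite B" "E \<subseteq> span B" and nz: "\<exists>x\<in>E. x \<noteq> 0"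
    and bil: "bilinear \<beta>" and sym: "\<And>x y. \<beta> x y = \<beta> y x"
    and pos: "\<And>x. x \<in> E \<Longrightarrow> x \<noteq> 0 \<Longrightarrow> \<beta> x x > 0"
    and qbil: "bilinear q" and qsym: "\<And>x y. x \<in> E \<Longrightarrow> y \<in> E \<Longrightarrow> q x y = q y x"
  obtains u l where "u \<in> E" "u \<noteq> 0" "\<And>w. w \<in> E \<Longrightarrow> q u w = l * \<beta> u w"
    "\<And>w. w \<in> E \<Longrightarrow> q w w \<ge> l * \<beta> w w"
proof -
  note bs = bilinear_simps[OF bil] and qs = bilinear_simps[OF qbil]
  obtain C where C: "C \<subseteq> E" "independent C" "E \<subseteq> span C"
    using maximal_independent_subset by blast
  with E have "finite C" using independent_span_bound by blast
  have spC: "span C = E" using C E(1) by (simp add: span_minimal subset_antisym)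
  obtain n :: nat and e where e: "\<And>i. i < n \<Longrightarrow> e i \<in> E"
    and o: "\<And>i j. i < n \<Longrightarrow> j < n \<Longrightarrow> \<beta> (e i) (e j) = (if i = j then 1 else 0)"
    and ex: "\<And>x. x \<in> E \<Longrightarrow> x = (\<Sum>i<n. \<beta> x (e i) *\<^sub>R e i)"
    using orthonormal_basis_exists[OF \<open>finite C\<close> bil sym] pos spC by metis
  define v where "v a = (\<Sum>i<n. a i *\<^sub>R e i)" for a :: "nat \<Rightarrow> real"
  have vE: "v a \<in> E" for a
    unfolding v_def by (intro subspace_sum subspace_scale E(1) e) auto
  have bv: "\<beta> (v a) (v a) = (\<Sum>i<n. (a i)\<^sup>2)" for a
  proof -
    have "\<beta> (v a) (v a) = (\<Sum>i<n. \<Sum>j<n. a i * (a j * (if i = j then 1 else 0)))"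
      unfolding v_def bilinear_lsum[OF bil] bilinear_rsum[OF bil]
      by (intro sum.cong refl) (simp add: bs o)
    also have "\<dots> = (\<Sum>i<n. (a i)\<^sup>2)"
      by (intro sum.cong) (auto simp: power2_eq_square mult_delta_right)
    finally show ?thesis .
  qed
  have qv: "q (v a) (v a) = (\<Sum>i<n. \<Sum>j<n. a i * a j * q (e i) (e j))" for a
    unfolding v_def bilinear_lsum[OF qbil] bilinear_rsum[OF qbil]
    by (intro sum.cong refl) (auto simp: qs intro: qsym e)
  \<comment> \<open>Only the first \<open>n\<close> coordinates describe a vector; the remaining
    ones are bounded but free, and \<open>v\<close> ignores them.\<close>
  define K where "K = {a :: nat \<Rightarrow> real. \<forall>i. a i \<in> {-1..1}} \<inter> {a. (\<Sum>i<n. (a i)\<^sup>2) = 1}"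
  have cont: "continuous_on UNIV (\<lambda>a :: nat \<Rightarrow> real. \<Sum>i<n. (a i)\<^sup>2)"
    "continuous_on UNIV (\<lambda>a. q (v a) (v a))"
    unfolding qv by (intro continuous_intros continuous_on_product_coordinates)+
  then have "closed {a :: nat \<Rightarrow> real. (\<Sum>i<n. (a i)\<^sup>2) = 1}"
    by (intro closed_Collect_eq continuous_on_const)
  then have "compact K" unfolding K_def using compact_real_fun_box by (rule compact_Int_closed[rotated])
  have unit: "\<exists>a\<in>K. x = sqrt (\<beta> x x) *\<^sub>R v a" if "x \<in> E" "x \<noteq> 0" for x
  proof -
    have b: "\<beta> x x > 0" using pos that by blast
    define a where "a i = (if i < n then \<beta> x (e i) / sqrt (\<beta> x x) else 0)" for i
    have "v a = (1 / sqrt (\<beta> x x)) *\<^sub>R (\<Sum>i<n. \<beta> x (e i) *\<^sub>R e i)"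
      unfolding v_def scaleR_sum_right by (intro sum.cong) (auto simp: a_def)
    then have va: "v a = (1 / sqrt (\<beta> x x)) *\<^sub>R x" by (simp only: ex[OF that(1), symmetric])
    have s1: "(\<Sum>i<n. (a i)\<^sup>2) = 1"
      using b by (simp flip: bv) (simp add: va bs)
    have "\<bar>a i\<bar> \<le> 1" for i
    proof (cases "i < n")
      case True
      then have "(a i)\<^sup>2 \<le> (\<Sum>i<n. (a i)\<^sup>2)"
        by (intro member_le_sum) auto
      then show ?thesis using s1 by (simp add: abs_square_le_1)
    qed (simp add: a_def)
    then have "a \<in> K" using s1 by (simp add: K_def abs_le_iff)
    then show ?thesis using va b by (intro bexI[of _ a]) auto
  qed
  then have "K \<noteq> {}" using nz by blast
  then obtain a where a: "a \<in> K" "\<And>b. b \<in> K \<Longrightarrow> q (v a) (v a) \<le> q (v b) (v b)"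
    using continuous_attains_inf[OF \<open>compact K\<close> _ continuous_on_subset[OF cont(2)]] by blast
  define u l where "u = v a" and "l = q (v a) (v a)"
  have u1: "\<beta> u u = 1" using a(1) by (simp add: u_def bv K_def)
  have uE: "u \<in> E" by (simp add: u_def vE)
  have min: "q w w \<ge> l * \<beta> w w" if w: "w \<in> E" for w
  proof (cases "w = 0")
    case False
    with w obtain b where b: "b \<in> K" "w = sqrt (\<beta> w w) *\<^sub>R v b" using unit by blast
    have p: "\<beta> w w > 0" using pos w False by blast
    have "q w w = \<beta> w w * q (v b) (v b)"
      using p by (subst b(2), subst (2) b(2)) (simp add: qs)
    then show ?thesis using a(2)[OF b(1)] p by (simp add: l_def mult.commute)
  qed (simp add: bs qs)
  text \<open>The form \<open>q - l \<beta>\<close> is semidefinite and vanishes on \<open>u\<close>, so \<open>u\<close> lies in its kernel.\<close>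
  have "q u w = l * \<beta> u w" if w: "w \<in> E" for w
  proof (rule ccontr)
    define r s where "r = q u w - l * \<beta> u w" and "s = q w w - l * \<beta> w w"
    assume "q u w \<noteq> l * \<beta> u w"
    then have r0: "r \<noteq> 0" by (simp add: r_def)
    have key: "0 \<le> 2 * k * r + k\<^sup>2 * s" for k
    proof -
      have "u + k *\<^sub>R w \<in> E" using uE w E(1) by (intro subspace_add subspace_scale)
      from min[OF this] show ?thesis
        using qsym[OF uE w] sym[of u w] u1
        by (simp add: bs qs r_def s_def l_def u_def power2_eq_square algebra_simps)
    qed
    have "s \<ge> 0" using min[OF w] by (simp add: s_def)
    \<comment> \<open>The minimum of the quadratic is at \<open>- r / s\<close>, but
      \<open>s\<close> may be 0; with \<open>s + 1\<close> in the denominator the value is still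
      negative.\<close>
    have "0 \<le> 2 * (- r / (s + 1)) * r + (- r / (s + 1))\<^sup>2 * s" by (rule key)
    also have "\<dots> = - (r\<^sup>2 * (s + 2)) / (s + 1)\<^sup>2"
      using \<open>s \<ge> 0\<close> by (simp add: divide_simps power2_eq_square) (simp add: algebra_simps)
    also have "\<dots> < 0" using r0 \<open>s \<ge> 0\<close> by (simp add: divide_neg_pos)
    finally show False by simp
  qed
  with min uE u1 show ?thesis
    by (intro that[of u l]) (auto simp: bs)
qed

lemma linear_between_0: "0 \<in> V \<Longrightarrow> linear_between V W f \<Longrightarrow> f 0 = 0"
  unfolding linear_between_def by (metis scaleR_zero_left)

lemma linear_between_sum:
  assumes V: "subspace V" and f: "linear_between V W f" and "finite I" "\<And>i. i \<in> I \<Longrightarrow> y i \<in> V"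
  shows "f (\<Sum>i\<in>I. a i *\<^sub>R y i) = (\<Sum>i\<in>I. a i *\<^sub>R f (y i))"
  using assms(3,4)
proof (induction I rule: finite_induct)
  case empty
  then show ?case using linear_between_0[OF subspace_0[OF V] f] by simp
next
  case (insert i I)
  have "(\<Sum>i\<in>I. a i *\<^sub>R y i) \<in> V" using insert V by (intro subspace_sum subspace_scale) auto
  then show ?case using insert f V by (auto simp: linear_between_def subspace_scale)
qed

text \<open>On \<open>V\<close> the map \<open>f\<close> is the sum of the rank-one maps sending
  \<open>x\<close> to \<open>k i x *\<^sub>R f (e i)\<close>, and each has trace
  \<open>k i (f (e i))\<close> in every basis. This frees \<open>endo_trace\<close> from its chosen
  basis, both for unimodularity and for the Killing form.\<close>

lemma endo_trace_coordinates:
  fixes e :: "nat \<Rightarrow> 'a::real_vector" and k :: "nat \<Rightarrow> 'a \<Rightarrow> real"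
  assumes V: "subspace V" "finite B" "span B = V"
    and f: "linear_between V V f"
    and e: "\<And>i. i < n \<Longrightarrow> e i \<in> V" and ex: "\<And>x. x \<in> V \<Longrightarrow> x = (\<Sum>i<n. k i x *\<^sub>R e i)"
    and k: "\<And>i. i < n \<Longrightarrow> linear_between V UNIV (k i)"
  shows "endo_trace V f = (\<Sum>i<n. k i (f (e i)))"
proof -
  define C where "C = (SOME B. independent B \<and> span B = V)"
  have "\<exists>B. independent B \<and> span B = V"
    by (metis V(1) maximal_independent_subset span_subspace subset_antisym span_minimal span_eq_iff)
  then have C: "independent C" "span C = V"
    unfolding C_def by (metis (mono_tags, lifting) someI_ex)+
  have "finite C" using C V independent_span_bound span_superset by metis
  have fV: "f x \<in> V" if "x \<in> V" for x using f that by (auto simp: linear_between_def)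
  have CV: "b \<in> V" if "b \<in> C" for b using that C span_base by blast
  have rlin: "linear_between V UNIV (\<lambda>x. representation C x b)" for b
    using C by (auto simp: linear_between_def representation_add representation_scale)
  have rep: "(\<Sum>b\<in>C. representation C x b *\<^sub>R b) = x" if "x \<in> V" for x
    using C \<open>finite C\<close> that by (intro sum_representation_eq) auto
  have "endo_trace V f = (\<Sum>b\<in>C. representation C (f b) b)"
    by (simp add: endo_trace_def C_def Let_def)
  also have "\<dots> = (\<Sum>b\<in>C. \<Sum>i<n. k i b * representation C (f (e i)) b)"
  proof (intro sum.cong refl)
    fix b assume b: "b \<in> C"
    have "f b = f (\<Sum>i<n. k i b *\<^sub>R e i)" by (simp only: ex[OF CV[OF b], symmetric])
    also have "\<dots> = (\<Sum>i<n. k i b *\<^sub>R f (e i))" by (rule linear_between_sum[OF V(1) f]) (auto intro: e)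
    finally have "representation C (f b) b = (\<Sum>i<n. k i b *\<^sub>R representation C (f (e i)) b)"
      using linear_between_sum[OF V(1) rlin, of "{..<n}" "\<lambda>i. f (e i)"] e fV by auto
    then show "representation C (f b) b = (\<Sum>i<n. k i b * representation C (f (e i)) b)" by simp
  qed
  also have "\<dots> = (\<Sum>i<n. \<Sum>b\<in>C. representation C (f (e i)) b *\<^sub>R k i b)"
    by (subst sum.swap) (simp add: mult.commute)
  also have "\<dots> = (\<Sum>i<n. k i (f (e i)))"
  proof (intro sum.cong refl)
    fix i assume "i \<in> {..<n}"
    then have fe: "f (e i) \<in> V" and "linear_between V UNIV (k i)" using e fV k by auto
    then have "k i (\<Sum>b\<in>C. representation C (f (e i)) b *\<^sub>R b)
        = (\<Sum>b\<in>C. representation C (f (e i)) b *\<^sub>R k i b)"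
      using \<open>finite C\<close> CV by (intro linear_between_sum[OF V(1)])
    then show "(\<Sum>b\<in>C. representation C (f (e i)) b *\<^sub>R k i b) = k i (f (e i))"
      by (simp only: rep[OF fe])
  qed
  finally show ?thesis .
qed

text \<open>Bilinearity and symmetry hold on the whole type, so computations carry no membership
  conditions; only positivity and expansion are relative to \<open>V\<close>.\<close>

locale orthonormal_frame =
  fixes V :: "'a::real_vector set" and g :: "'a \<Rightarrow> 'a \<Rightarrow> real"
    and n :: nat and e :: "nat \<Rightarrow> 'a"
  assumes V: "subspace V"
    and g_bilinear: "bilinear g"
    and g_sym: "g x y = g y x"
    and g_pos: "x \<in> V \<Longrightarrow> x \<noteq> 0 \<Longrightarrow> g x x > 0"
    and e_in: "i < n \<Longrightarrow> e i \<in> V"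
    and ortho: "i < n \<Longrightarrow> j < n \<Longrightarrow> g (e i) (e j) = (if i = j then 1 else 0)"
    and expand: "x \<in> V \<Longrightarrow> x = (\<Sum>i<n. g x (e i) *\<^sub>R e i)"
begin

lemmas gs = bilinear_simps[OF g_bilinear]

lemma V_simps [simp, intro]:
  "0 \<in> V" "x \<in> V \<Longrightarrow> y \<in> V \<Longrightarrow> x + y \<in> V" "x \<in> V \<Longrightarrow> y \<in> V \<Longrightarrow> x - y \<in> V"
  "x \<in> V \<Longrightarrow> c *\<^sub>R x \<in> V" "x \<in> V \<Longrightarrow> - x \<in> V"
  using V by (auto intro: subspace_0 subspace_add subspace_diff subspace_scale subspace_neg)

lemma g_nonneg: "x \<in> V \<Longrightarrow> g x x \<ge> 0"
  using g_pos[of x] by (cases "x = 0") (auto simp: gs)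

lemma g_eq_0: "x \<in> V \<Longrightarrow> g x x = 0 \<longleftrightarrow> x = 0"
  using g_pos[of x] by (cases "x = 0") (auto simp: gs)

lemma g_eqI:
  assumes "x \<in> V" "y \<in> V" "\<And>z. z \<in> V \<Longrightarrow> g x z = g y z"
  shows "x = y"
  using g_eq_0[of "x - y"] assms by (simp add: gs)

lemma linear_eq_on_frame:
  assumes "linear f" "linear h" "\<And>i. i < n \<Longrightarrow> f (e i) = h (e i)" "x \<in> V"
  shows "f x = h x"
proof -
  have "f (\<Sum>i<n. g x (e i) *\<^sub>R e i) = h (\<Sum>i<n. g x (e i) *\<^sub>R e i)"
    using assms(1-3) by (simp add: linear_sum linear_cmul)
  then show ?thesis by (simp only: expand[OF assms(4), symmetric])
qed

definition tr :: "('a \<Rightarrow> 'a) \<Rightarrow> real" where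
  "tr f = (\<Sum>i<n. g (f (e i)) (e i))"

lemma tr_cong: "(\<And>x. x \<in> V \<Longrightarrow> f x = h x) \<Longrightarrow> tr f = tr h"
  by (simp add: tr_def e_in)

lemma tr_add: "tr (\<lambda>x. f x + h x) = tr f + tr h"
  and tr_diff: "tr (\<lambda>x. f x - h x) = tr f - tr h"
  and tr_scale: "tr (\<lambda>x. k *\<^sub>R f x) = k * tr f"
  by (simp_all add: tr_def gs sum.distrib sum_subtractf sum_distrib_left)

lemma tr_id: "tr (\<lambda>x. x) = n"
  by (simp add: tr_def ortho)

lemma tr_comp:
  assumes "linear f" "linear h" "\<And>x. x \<in> V \<Longrightarrow> f x \<in> V" "\<And>x. x \<in> V \<Longrightarrow> h x \<in> V"
  shows "tr (\<lambda>x. f (h x)) = tr (\<lambda>x. h (f x))"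
proof -
  have *: "tr (\<lambda>x. f (h x)) = (\<Sum>i<n. \<Sum>j<n. g (h (e i)) (e j) * g (f (e j)) (e i))"
    if "linear f" "\<And>x. x \<in> V \<Longrightarrow> h x \<in> V" for f h
    unfolding tr_def
  proof (intro sum.cong refl)
    fix i assume i: "i \<in> {..<n}"
    have "f (h (e i)) = f (\<Sum>j<n. g (h (e i)) (e j) *\<^sub>R e j)"
      using i that(2)[OF e_in] by (simp only: lessThan_iff expand[symmetric])
    also have "\<dots> = (\<Sum>j<n. g (h (e i)) (e j) *\<^sub>R f (e j))"
      using that(1) by (simp add: linear_sum linear_cmul)
    finally show "g (f (h (e i))) (e i) = (\<Sum>j<n. g (h (e i)) (e j) * g (f (e j)) (e i))"
      by (simp add: bilinear_lsum[OF g_bilinear] gs)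
  qed
  have "tr (\<lambda>x. f (h x)) = (\<Sum>i<n. \<Sum>j<n. g (h (e i)) (e j) * g (f (e j)) (e i))"
    by (rule *) (use assms in auto)
  also have "\<dots> = (\<Sum>i<n. \<Sum>j<n. g (f (e i)) (e j) * g (h (e j)) (e i))"
    by (subst sum.swap) (simp add: mult.commute)
  also have "\<dots> = tr (\<lambda>x. h (f x))"
    by (rule *[symmetric]) (use assms in auto)
  finally show ?thesis .
qed

text \<open>The matrix identities for the adjugate, carried over to an operator through its matrix
  in the frame. Where \<open>poly p l\<close> is nonzero, \<open>Adj l\<close> inverts
  \<open>l - R\<close> up to that factor, without any division.\<close>

lemma operator_adjugate:
  assumes R: "linear R" "\<And>x. x \<in> V \<Longrightarrow> R x \<in> V"
  shows "\<exists>(p :: real poly) Adj. p \<noteq> 0 \<and> (\<forall>l. linear (Adj l)) \<and> (\<forall>l x. Adj l x \<in> V) \<and>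
    (\<forall>l. \<forall>x\<in>V. Adj l (l *\<^sub>R x - R x) = poly p l *\<^sub>R x) \<and>
    (\<forall>l. \<forall>x\<in>V. l *\<^sub>R Adj l x - R (Adj l x) = poly p l *\<^sub>R x) \<and>
    (\<forall>l. tr (Adj l) = poly (pderiv p) l)"
proof -
  define a where "a i j = g (R (e j)) (e i)" for i j
  obtain p B where "p \<noteq> 0"
    and AB: "\<And>l i j. i < n \<Longrightarrow> j < n \<Longrightarrow>
      (\<Sum>k<n. ((if i = k then l else 0) - a i k) * poly (B k j) l) = (if i = j then poly p l else 0)"
    and BA: "\<And>l i j. i < n \<Longrightarrow> j < n \<Longrightarrow>
      (\<Sum>k<n. poly (B i k) l * ((if k = j then l else 0) - a k j)) = (if i = j then poly p l else 0)"
    and trB: "(\<Sum>i<n. B i i) = pderiv p"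
    using char_poly_adjugate[of n a] by blast
  \<comment> \<open>The operator with matrix \<open>B\<close> at \<open>l\<close>, preceded by the
    orthogonal projection to \<open>V\<close>; hence it is linear everywhere and always lands in
    \<open>V\<close>.\<close>
  define Adj where "Adj l x = (\<Sum>i<n. \<Sum>k<n. (poly (B i k) l * g x (e k)) *\<^sub>R e i)" for l x
  have lin: "linear (Adj l)" for l
    by (intro linearI)
      (simp_all add: Adj_def gs algebra_simps sum.distrib scaleR_sum_right mult.left_commute)
  have Re: "l *\<^sub>R e j - R (e j) = (\<Sum>k<n. ((if k = j then l else 0) - a k j) *\<^sub>R e k)"
    if "j < n" for j l
  proof -
    have "l *\<^sub>R e j - R (e j) \<in> V" using that R(2) e_in by simp
    from expand[OF this] show ?thesis
      by (rule trans) (intro sum.cong refl, auto simp: gs ortho that a_def)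
  qed
  have delta: "(\<Sum>i<n. (if i = j then k else 0) *\<^sub>R e i) = k *\<^sub>R e j" if "j < n" for j k
    using that by (simp add: if_distrib[of "\<lambda>r. r *\<^sub>R _"] cong: if_cong)
  have Ae: "Adj l (e j) = (\<Sum>i<n. poly (B i j) l *\<^sub>R e i)" if "j < n" for l j
    unfolding Adj_def
  proof (intro sum.cong refl)
    fix i
    have "(\<Sum>k<n. (poly (B i k) l * g (e j) (e k)) *\<^sub>R e i)
      = (\<Sum>k<n. if k = j then poly (B i k) l *\<^sub>R e i else 0)"
      using that by (intro sum.cong) (auto simp: ortho)
    then show "(\<Sum>k<n. (poly (B i k) l * g (e j) (e k)) *\<^sub>R e i) = poly (B i j) l *\<^sub>R e i"
      using that by simp
  qed
  have A1: "Adj l (l *\<^sub>R e j - R (e j)) = poly p l *\<^sub>R e j" if "j < n" for l j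
  proof -
    have "Adj l (l *\<^sub>R e j - R (e j))
      = (\<Sum>k<n. ((if k = j then l else 0) - a k j) *\<^sub>R (\<Sum>i<n. poly (B i k) l *\<^sub>R e i))"
      unfolding Re[OF that] using lin[of l] by (simp add: linear_sum linear_cmul Ae)
    also have "\<dots> = (\<Sum>i<n. (\<Sum>k<n. poly (B i k) l * ((if k = j then l else 0) - a k j)) *\<^sub>R e i)"
      by (simp add: scaleR_sum_right scaleR_sum_left mult.commute) (rule sum.swap)
    finally show ?thesis using that by (simp add: BA delta)
  qed
  have A2: "l *\<^sub>R Adj l (e j) - R (Adj l (e j)) = poly p l *\<^sub>R e j" if "j < n" for l j
  proof -
    have "l *\<^sub>R Adj l (e j) - R (Adj l (e j)) = (\<Sum>k<n. poly (B k j) l *\<^sub>R (l *\<^sub>R e k - R (e k)))"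
      using R(1) that
      by (simp add: Ae linear_sum linear_cmul scaleR_sum_right sum_subtractf algebra_simps)
    also have "\<dots> = (\<Sum>k<n. poly (B k j) l *\<^sub>R (\<Sum>i<n. ((if i = k then l else 0) - a i k) *\<^sub>R e i))"
      by (intro sum.cong refl) (simp only: Re lessThan_iff)
    also have "\<dots> = (\<Sum>i<n. (\<Sum>k<n. ((if i = k then l else 0) - a i k) * poly (B k j) l) *\<^sub>R e i)"
      by (simp add: scaleR_sum_right scaleR_sum_left mult.commute) (rule sum.swap)
    finally show ?thesis using that by (simp add: AB delta)
  qed
  have lin1: "linear (\<lambda>x. Adj l (l *\<^sub>R x - R x))" for l
    using linear_compose[OF linear_compose_sub[OF linear_compose_scale_right[OF linear_ident] R(1)] lin]
    by (simp add: o_def)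
  have lin2: "linear (\<lambda>x. l *\<^sub>R Adj l x - R (Adj l x))" for l
    using linear_compose_sub[OF linear_compose_scale_right[OF lin] linear_compose[OF lin R(1)]]
    by (simp add: o_def)
  show ?thesis
  proof (intro exI[of _ p] exI[of _ Adj] conjI allI ballI)
    fix l x
    show "Adj l x \<in> V" unfolding Adj_def by (intro subspace_sum subspace_scale V e_in) simp
  next
    fix l x assume x: "x \<in> V"
    show "Adj l (l *\<^sub>R x - R x) = poly p l *\<^sub>R x"
      by (rule linear_eq_on_frame[OF lin1 _ A1 x]) (simp_all add: linear_compose_scale_right linear_ident)
  next
    fix l x assume x: "x \<in> V"
    show "l *\<^sub>R Adj l x - R (Adj l x) = poly p l *\<^sub>R x"
      by (rule linear_eq_on_frame[OF lin2 _ A2 x]) (simp_all add: linear_compose_scale_right linear_ident)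
  next
    fix l
    have "tr (Adj l) = (\<Sum>j<n. \<Sum>i<n. if i = j then poly (B i j) l else 0)"
      unfolding tr_def
      by (intro sum.cong refl) (auto simp: Ae bilinear_lsum[OF g_bilinear] gs ortho mult_delta_right)
    then show "tr (Adj l) = poly (pderiv p) l" by (simp flip: trB add: poly_sum)
  qed (use \<open>p \<noteq> 0\<close> lin in auto)
qed

end

subsection \<open>Flat Weyl connections\<close>

text \<open>The name refers to \<open>weyl\<close>: each \<open>D x\<close> is an infinitesimal
  similarity, \<open>g t x\<close> times the identity plus a skew map. Conditions such as
  \<open>D_in\<close> can be asked of all arguments because the data will be composed with a
  projection onto \<open>V\<close>.\<close>

locale flat_similarity = orthonormal_frame V g n e
  for V :: "'a::real_vector set" and g n e +
  fixes D :: "'a \<Rightarrow> 'a \<Rightarrow> 'a" and t :: 'a and br :: "'a \<Rightarrow> 'a \<Rightarrow> 'a"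
  assumes D_bilinear: "bilinear D"
    and D_in [simp]: "D x y \<in> V"
    and t_in [simp]: "t \<in> V" and t_nz: "t \<noteq> 0"
    and br_eq: "br x y = D x y - D y x"
    and flat: "D (br x y) u = D x (D y u) - D y (D x u)"
    and weyl: "g (D x y) z + g y (D x z) = 2 * g t x * g y z"
    and closed: "g t (br x y) = 0"
    and unimod: "x \<in> V \<Longrightarrow> tr (br x) = 0"
begin

lemmas Ds = bilinear_simps[OF D_bilinear]

definition c :: real where "c = g t t"
definition H :: "'a set" where "H = {x \<in> V. g t x = 0}"

lemma c_pos: "c > 0"
  by (simp add: c_def g_pos t_nz)

lemma linear_D: "linear (D x)" "linear (\<lambda>x. D x y)"
  using D_bilinear by (auto simp: bilinear_def)

lemma tr_D: "tr (D x) = n * g t x"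
proof -
  have "g (D x (e i)) (e i) = g t x" if "i < n" for i
    using weyl[of x "e i" "e i"] g_sym[of "D x (e i)" "e i"] that by (simp add: ortho)
  then show ?thesis by (simp add: tr_def)
qed

text \<open>Since \<open>br x\<close> is \<open>D x\<close> minus \<open>R x\<close> and is
  traceless, \<open>R x\<close> has the trace of \<open>D x\<close>.\<close>

lemma tr_R: "x \<in> V \<Longrightarrow> tr (\<lambda>y. D y x) = n * g t x"
  using unimod[of x] tr_diff[of "D x" "\<lambda>y. D y x"]
  by (simp add: br_eq[abs_def] tr_D)

text \<open>Symmetry of the Hessian of a closed form: in the difference of the two instances of
  \<open>weyl\<close> the only obstruction is \<open>g t (br x y)\<close>, which vanishes.\<close>

lemma R_t_sym: "g (D x t) y = g (D y t) x"
  using weyl[of x t y] weyl[of y t x] closed[of x y] by (simp add: br_eq gs g_sym algebra_simps)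

lemma D_t_t: "D t t = c *\<^sub>R t"
proof (rule g_eqI)
  fix z
  have "g (D t t) z = g (D z t) t" by (rule R_t_sym)
  also have "\<dots> = c * g t z" using weyl[of z t t] g_sym[of t "D z t"] g_sym[of t z] by (simp add: c_def)
  finally show "g (D t t) z = g (c *\<^sub>R t) z" by (simp add: gs)
qed simp_all

text \<open>The symmetric endomorphism \<open>x \<mapsto> D x t - c x\<close> vanishes because the trace of its square does:
  flatness gives \<open>R\<^sub>t\<^sup>2 - R\<^sub>t D\<^sub>t = c R\<^sub>t - D\<^sub>t R\<^sub>t\<close>.\<close>

lemma R_t:
  assumes "x \<in> V"
  shows "D x t = c *\<^sub>R x"
proof -
  let ?R = "\<lambda>x. D x t"
  have "D (D x t) t - D (D t x) t = c *\<^sub>R D x t - D t (D x t)" for x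
    using flat[of x t t] by (simp add: br_eq Ds D_t_t)
  then have "tr (\<lambda>x. D (D x t) t) - tr (\<lambda>x. D (D t x) t) = c * tr ?R - tr (\<lambda>x. D t (D x t))"
    by (simp flip: tr_diff tr_scale)
  moreover have "tr (\<lambda>x. D (D t x) t) = tr (\<lambda>x. D t (D x t))"
    by (rule tr_comp[of ?R "D t"]) (simp_all add: linear_D)
  ultimately have RR: "tr (\<lambda>x. D (D x t) t) = c * tr ?R" by simp
  have R: "tr ?R = n * c" by (simp add: tr_R c_def)
  have sq: "g (D x t - c *\<^sub>R x) (D x t - c *\<^sub>R x)
      = g (D (D x t) t) x - 2 * c * g (D x t) x + c\<^sup>2 * g x x" for x
    using R_t_sym[of "D x t" x] g_sym[of x "D x t"]
    by (simp add: gs power2_eq_square algebra_simps)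
  have "(\<Sum>i<n. g (D (e i) t - c *\<^sub>R e i) (D (e i) t - c *\<^sub>R e i))
      = tr (\<lambda>x. D (D x t) t) - 2 * c * tr ?R + c\<^sup>2 * tr (\<lambda>x. x)"
    by (simp add: tr_def sq sum_distrib_left sum.distrib sum_subtractf)
  also have "\<dots> = 0" by (simp add: RR R tr_id power2_eq_square)
  finally have "\<forall>i\<in>{..<n}. g (D (e i) t - c *\<^sub>R e i) (D (e i) t - c *\<^sub>R e i) = 0"
    by (subst (asm) sum_nonneg_eq_0_iff) (auto intro!: g_nonneg e_in)
  then have "D (e i) t = c *\<^sub>R e i" if "i < n" for i
    using that g_eq_0[of "D (e i) t - c *\<^sub>R e i"] e_in by auto
  then show ?thesis
    by (rule linear_eq_on_frame[OF linear_D(2) linear_compose_scale_right[OF linear_ident] _ assms])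
qed

lemma n_pos: "n > 0"
  using expand[OF t_in] t_nz by (cases n) auto

text \<open>With \<open>p\<close> the characteristic polynomial of \<open>x \<mapsto> D x w\<close>, the flatness equation for \<open>v = (l / c) t - w\<close>,
  multiplied by the adjugate of \<open>x \<mapsto> D x v\<close> and traced, gives \<open>p' (l\<^sup>2 + c |w|\<^sup>2) = n l p\<close>.\<close>

lemma R_no_eigenvalue:
  assumes w: "w \<in> H" "w \<noteq> 0" and x: "x \<in> V" "D x w = l *\<^sub>R x"
  shows "x = 0"
proof -
  have wV: "w \<in> V" and tw: "g t w = 0" using w by (auto simp: H_def)
  obtain p Adj where p0: "p \<noteq> 0" and lin: "\<And>l. linear (Adj l)" and AV: "\<And>l x. Adj l x \<in> V"
    and A1: "\<And>l x. x \<in> V \<Longrightarrow> Adj l (l *\<^sub>R x - D x w) = poly p l *\<^sub>R x"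
    and A2: "\<And>l x. x \<in> V \<Longrightarrow> l *\<^sub>R Adj l x - D (Adj l x) w = poly p l *\<^sub>R x"
    and trA: "\<And>l. tr (Adj l) = poly (pderiv p) l"
    using operator_adjugate[OF linear_D(2)[of w] D_in] by blast
  have "poly (pderiv p) l * (l\<^sup>2 + c * g w w) = real n * l * poly p l" if pl: "poly p l \<noteq> 0" for l :: real
  proof -
    \<comment> \<open>As \<open>R t\<close> is multiplication by \<open>c\<close>, this choice makes
      \<open>R v\<close> equal to \<open>l - R w\<close>, the operator to which \<open>Adj l\<close>
      belongs.\<close>
    define v where "v = (l / c) *\<^sub>R t - w"
    have Dv: "D x v = l *\<^sub>R x - D x w" if "x \<in> V" for x
      using c_pos that by (simp add: v_def Ds R_t)
    \<comment> \<open>Up to the factor \<open>poly p l\<close>, the preimage of \<open>t\<close>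
      under \<open>R v\<close>; then \<open>D y (D x0 v)\<close> is a multiple of
      \<open>y\<close>.\<close>
    define x0 where "x0 = Adj l t"
    have x0: "D x0 v = poly p l *\<^sub>R t" by (simp add: Dv x0_def AV A2)
    have AD: "Adj l (D x v) = poly p l *\<^sub>R x" if "x \<in> V" for x
      using that by (simp add: Dv A1)
    have id: "(poly p l * c) *\<^sub>R Adj l y
        = Adj l (D x0 (D y v)) - poly p l *\<^sub>R D x0 y + poly p l *\<^sub>R D y x0" if "y \<in> V" for y
    proof -
      have "D y (D x0 v) = D x0 (D y v) - D (D x0 y) v + D (D y x0) v"
        using flat[of x0 y v] by (simp add: br_eq Ds algebra_simps)
      then have "Adj l (D y (D x0 v)) = Adj l (D x0 (D y v) - D (D x0 y) v + D (D y x0) v)"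
        by simp
      then show ?thesis
        using that by (simp add: x0 Ds R_t linear_add[OF lin] linear_diff[OF lin] linear_cmul[OF lin] AD)
    qed
    have "poly p l * c * tr (Adj l)
        = tr (\<lambda>y. Adj l (D x0 (D y v))) - poly p l * tr (D x0) + poly p l * tr (\<lambda>y. D y x0)"
      using tr_cong[OF id] by (simp add: tr_add tr_diff tr_scale)
    \<comment> \<open>Cyclicity brings \<open>Adj l\<close> next to \<open>R v\<close>; the result
      cancels the trace of \<open>D x0\<close>, so only the trace of \<open>R x0\<close>
      survives.\<close>
    also have "tr (\<lambda>y. Adj l (D x0 (D y v))) = tr (\<lambda>y. D x0 (D (Adj l y) v))"
      by (rule tr_comp[OF lin, of "\<lambda>y. D x0 (D y v)"])
        (simp_all add: AV linear_compose[OF linear_D(2)[of v] linear_D(1)[of x0], unfolded o_def])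
    also have "\<dots> = tr (\<lambda>y. poly p l *\<^sub>R D x0 y)"
      by (intro tr_cong) (simp add: Dv AV A2 Ds)
    finally have "c * poly (pderiv p) l = n * g t x0"
      using pl by (simp add: tr_scale tr_R x0_def AV trA)
    \<comment> \<open>Pairing \<open>D x0 v\<close> with \<open>v\<close> evaluates the unknown
      \<open>g t x0\<close>: the similarity property gives one value, the choice of
      \<open>x0\<close> the other.\<close>
    moreover have "poly p l * l = g t x0 * (l\<^sup>2 / c + g w w)"
    proof -
      have "g (D x0 v) v = g t x0 * g v v"
        using weyl[of x0 v v] g_sym[of v "D x0 v"] by simp
      moreover have "g v v = l\<^sup>2 / c + g w w"
        using c_pos tw g_sym[of w t] by (simp add: v_def gs power2_eq_square flip: c_def)
      moreover have "g t v = l" using c_pos tw by (simp add: v_def gs flip: c_def)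
      ultimately show ?thesis by (simp add: x0 gs)
    qed
    ultimately have "c * poly (pderiv p) l * (l\<^sup>2 / c + g w w) = n * (poly p l * l)"
      by simp
    then show ?thesis using c_pos by (simp add: algebra_simps)
  qed
  then have "poly p l \<noteq> 0"
    by (intro no_real_root_if_log_derivative[OF p0, of "c * g w w" n])
      (use w wV c_pos g_pos n_pos in auto)
  then show "x = 0" using A1[OF x(1), of l] x(2) by (simp add: linear_0[OF lin])
qed

text \<open>Write \<open>v = a t - w\<close> with \<open>w\<close> in \<open>H\<close>. Then
  \<open>x\<close> would be an eigenvector of \<open>R w\<close> with eigenvalue \<open>a c\<close>,
  so \<open>w = 0\<close>; but \<open>R (a t)\<close> is multiplication by
  \<open>a c\<close>.\<close>

lemma D_eq_0:
  assumes "x \<in> V" "v \<in> V" "D x v = 0"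
  shows "x = 0 \<or> v = 0"
proof (rule ccontr)
  assume nz: "\<not> (x = 0 \<or> v = 0)"
  define a where "a = g t v / c"
  define w where "w = a *\<^sub>R t - v"
  have wH: "w \<in> H" using c_pos assms by (simp add: H_def w_def a_def gs flip: c_def)
  have "D x w = (a * c) *\<^sub>R x" using assms by (simp add: w_def Ds R_t)
  with R_no_eigenvalue[OF wH] nz assms have "w = 0" by blast
  then have v: "v = a *\<^sub>R t" by (simp add: w_def)
  then have "(a * c) *\<^sub>R x = 0" using assms by (simp add: Ds R_t)
  then show False using nz v c_pos by simp
qed

end

section \<open>The invariant form on the kernel, and its commuting elements\<close>

context flat_similarity
begin

lemma subspace_H: "subspace H"
  using V by (auto simp: H_def subspace_def gs)

lemma H_V: "x \<in> H \<Longrightarrow> x \<in> V"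
  by (simp add: H_def)

lemma H_simps [simp, intro]:
  "0 \<in> H" "x \<in> H \<Longrightarrow> y \<in> H \<Longrightarrow> x + y \<in> H" "x \<in> H \<Longrightarrow> y \<in> H \<Longrightarrow> x - y \<in> H"
  "x \<in> H \<Longrightarrow> k *\<^sub>R x \<in> H" "x \<in> H \<Longrightarrow> - x \<in> H"
  using subspace_H by (auto intro: subspace_0 subspace_add subspace_diff subspace_scale subspace_neg)

lemma br_in_H [simp]: "br x y \<in> H"
  by (simp add: H_def closed) (simp add: br_eq)

lemma V_span: "V \<subseteq> span (e ` {..<n})"
proof
  fix x assume "x \<in> V"
  then have "x = (\<Sum>i<n. g x (e i) *\<^sub>R e i)" by (rule expand)
  also have "\<dots> \<in> span (e ` {..<n})" by (intro span_sum span_scale span_base) auto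
  finally show "x \<in> span (e ` {..<n})" .
qed

lemma H_span: "H \<subseteq> span (e ` {..<n})"
  using V_span by (auto simp: H_def)

lemma skew: "x \<in> H \<Longrightarrow> g (D x y) z = - g y (D x z)"
  using weyl[of x y z] by (simp add: H_def)

lemma br_bilinear: "bilinear br"
  by (simp add: bilinear_def linear_iff br_eq Ds algebra_simps)

lemmas brs = bilinear_simps[OF br_bilinear]

lemma br_self [simp]: "br x x = 0"
  by (simp add: br_eq)

lemma br_anti: "br x y = - br y x"
  by (simp add: br_eq)

text \<open>The first Bianchi identity: expand \<open>br\<close> by \<open>br_eq\<close> and use
  flatness; all terms cancel in pairs.\<close>

lemma jacobi: "br x (br y z) = br (br x y) z + br y (br x z)"
proof -
  have *: "br x (br y z) = D x (D y z) - D x (D z y) - D y (D z x) + D z (D y x)" for x y z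
    unfolding br_eq[of x "br y z"] flat by (simp add: br_eq Ds)
  show ?thesis
    unfolding br_anti[of "br x y" z] * by (simp add: algebra_simps)
qed

text \<open>Built from \<open>D\<close> and not from the adjoint action: the Killing form of
  \<open>H\<close> vanishes when \<open>H\<close> is a line, while this form stays definite.\<close>

definition \<beta> :: "'a \<Rightarrow> 'a \<Rightarrow> real" where
  "\<beta> x y = - tr (\<lambda>u. D x (D y u))"

lemma \<beta>_bilinear: "bilinear \<beta>"
  by (simp add: bilinear_def linear_iff \<beta>_def tr_def Ds gs sum.distrib sum_distrib_left)

lemmas \<beta>s = bilinear_simps[OF \<beta>_bilinear]

lemma \<beta>_sym: "\<beta> x y = \<beta> y x"
  using tr_comp[of "D x" "D y"] by (simp add: \<beta>_def linear_D)

lemma \<beta>_inv: "\<beta> (br x y) z = \<beta> x (br y z)"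
proof -
  have "tr (\<lambda>u. D y (D x (D z u))) = tr (\<lambda>u. D x (D z (D y u)))"
    using tr_comp[of "D y" "\<lambda>u. D x (D z u)"] linear_D
      linear_compose[OF linear_D(1)[of z] linear_D(1)[of x]] by (simp add: o_def)
  then show ?thesis by (simp add: \<beta>_def flat Ds tr_diff)
qed

lemma \<beta>_skew: "\<beta> (br x y) z = - \<beta> y (br x z)"
  using \<beta>_inv[of y x z] by (simp add: br_anti[of x y] \<beta>s)

text \<open>For skew \<open>D x\<close> the value is the sum of the square lengths of
  \<open>D x (e i)\<close>, none of which is zero by \<open>D_eq_0\<close>.\<close>

lemma \<beta>_pos:
  assumes "x \<in> H" "x \<noteq> 0"
  shows "\<beta> x x > 0"
proof -
  have b: "\<beta> x x = (\<Sum>i<n. g (D x (e i)) (D x (e i)))"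
    by (simp add: \<beta>_def tr_def skew[OF assms(1), of "D x _"] sum_negf)
  have "g (D x (e i)) (D x (e i)) > 0" if "i < n" for i
  proof -
    have "e i \<noteq> 0" using ortho[OF that that] by (auto simp: gs)
    then show ?thesis
      using D_eq_0[of x "e i"] assms that by (intro g_pos) (auto simp: H_V e_in)
  qed
  then show ?thesis unfolding b using n_pos by (intro sum_pos) auto
qed

lemma \<beta>_nonneg: "x \<in> H \<Longrightarrow> \<beta> x x \<ge> 0"
  using \<beta>_pos[of x] by (cases "x = 0") (auto simp: \<beta>s)

lemma \<beta>_eq_0: "x \<in> H \<Longrightarrow> \<beta> x x = 0 \<longleftrightarrow> x = 0"
  using \<beta>_pos[of x] by (cases "x = 0") (auto simp: \<beta>s)

text \<open>Commuting skew maps have a common invariant plane, on which some combination of them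
  vanishes.\<close>

lemma rank_one:
  assumes x: "x \<in> H" "x \<noteq> 0" and y: "y \<in> H" and comm: "br x y = 0"
  shows "\<exists>k. y = k *\<^sub>R x"
proof -
  have xy: "D x (D y u) = D y (D x u)" for u
    using flat[of x y u] by (simp add: comm Ds)
  have bil: "bilinear (\<lambda>v w. g (D x v) (D x w))" "bilinear (\<lambda>v w. g (D y (D x v)) w)"
    by (simp_all add: bilinear_def linear_iff Ds gs)
  obtain u l where u: "u \<in> V" "u \<noteq> 0" "\<And>w. w \<in> V \<Longrightarrow> g (D x u) (D x w) = l * g u w"
    by (rule least_eigenvector[OF V finite_imageI[OF finite_lessThan] V_span _ g_bilinear g_sym g_pos bil(1)])
      (use t_nz g_sym in auto)
  have l: "l > 0"
  proof -
    have "D x u \<noteq> 0" using D_eq_0[of x u] x u by (auto simp: H_V)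
    then have "g (D x u) (D x u) > 0" by (simp add: g_pos)
    then show ?thesis using u(3)[OF u(1)] g_pos[OF u(1,2)] by (simp add: zero_less_mult_iff)
  qed
  \<comment> \<open>An eigenspace of the symmetric map \<open>D x\<close> squared;
    \<open>D y\<close> commutes with \<open>D x\<close> and therefore preserves it.\<close>
  define E where "E = {v \<in> V. D x (D x v) = (- l) *\<^sub>R v}"
  have E: "subspace E" "E \<subseteq> span (e ` {..<n})"
    using V V_span by (auto simp: E_def subspace_def Ds algebra_simps)
  have "D x (D x u) = (- l) *\<^sub>R u"
    by (rule g_eqI) (use u skew[OF x(1), of "D x u"] in \<open>auto simp: gs\<close>)
  then have uE: "u \<in> E" by (simp add: E_def u)
  \<comment> \<open>A product of two commuting skew maps is symmetric.\<close>
  have q: "g (D y (D x v)) w = g (D y (D x w)) v" for v w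
    using skew[OF y, of "D x v" w] skew[OF x(1), of v "D y w"] by (simp add: xy g_sym)
  obtain v k where v: "v \<in> E" "v \<noteq> 0" "\<And>w. w \<in> E \<Longrightarrow> g (D y (D x v)) w = k * g v w"
    by (rule least_eigenvector[OF E(1) finite_imageI[OF finite_lessThan] E(2) _ g_bilinear g_sym _ bil(2)])
      (use uE u q g_pos in \<open>auto simp: E_def\<close>)
  have vV: "v \<in> V" and vE: "D x (D x v) = (- l) *\<^sub>R v" using v(1) by (auto simp: E_def)
  \<comment> \<open>The eigenvalue equation is so far known only against vectors of
    \<open>E\<close>; the error term itself lies in \<open>E\<close>, so it is orthogonal to
    itself.\<close>
  have "D y (D x v) - k *\<^sub>R v \<in> E"
    using vV vE by (simp add: E_def Ds flip: xy) (simp add: Ds xy algebra_simps)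
  from v(3)[OF this] have "g (D y (D x v) - k *\<^sub>R v) (D y (D x v) - k *\<^sub>R v) = 0"
    using g_sym[of v "D y (D x v)"] by (simp add: gs)
  then have "D y (D x v) = k *\<^sub>R v"
    using g_eq_0[of "D y (D x v) - k *\<^sub>R v"] vV by simp
  then have "D x (D y (D x v)) = k *\<^sub>R D x v" by (simp add: Ds)
  \<comment> \<open>Applying \<open>D x\<close> to the eigenvalue equation and using
    \<open>D x (D x v) = - l v\<close> gives \<open>- l D y v = k D x v\<close>.\<close>
  then have "D (l *\<^sub>R y + k *\<^sub>R x) v = 0" by (simp add: xy vE Ds add_eq_0_iff)
  then have 0: "l *\<^sub>R y + k *\<^sub>R x = 0"
    using D_eq_0[of "l *\<^sub>R y + k *\<^sub>R x" v] v(2) x y vV by (auto simp: H_V)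
  have "y = (1 / l) *\<^sub>R (l *\<^sub>R y)" using l by simp
  also have "l *\<^sub>R y = (- k) *\<^sub>R x" using 0 by (simp add: add_eq_0_iff)
  finally show ?thesis by (intro exI[of _ "1 / l * - k"]) simp
qed

subsection \<open>The structure of the kernel of the Lee form\<close>

definition su2_triple :: "'a \<Rightarrow> 'a \<Rightarrow> 'a \<Rightarrow> bool" where
  "su2_triple x y z \<longleftrightarrow> br x y = z \<and> br y z = x \<and> br z x = y"

lemma su2_triple_rotate: "su2_triple x y z \<Longrightarrow> su2_triple y z x"
  by (auto simp: su2_triple_def)

lemma su2_triple_in_H: "su2_triple x y z \<Longrightarrow> x \<in> H \<and> y \<in> H \<and> z \<in> H"
  unfolding su2_triple_def by (metis br_in_H)

lemma su2_triple_br: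
  assumes "su2_triple x y z"
  shows "br x y = z" "br y z = x" "br z x = y" "br y x = - z" "br z y = - x" "br x z = - y"
  using assms br_anti[of y x] br_anti[of z y] br_anti[of x z] by (auto simp: su2_triple_def)

text \<open>Invariance gives \<open>\<beta> x (br x z) = \<beta> (br x x) z = 0\<close>, and
  \<open>br x z = - y\<close>.\<close>

lemma su2_triple_\<beta>:
  assumes "su2_triple x y z"
  shows "\<beta> x y = 0" "\<beta> y z = 0" "\<beta> x z = 0"
proof -
  have "\<beta> x y = 0" if "su2_triple x y z" for x y z
    using \<beta>_inv[of x x z] su2_triple_br[OF that] by (simp add: \<beta>s)
  from this[OF assms] this[OF su2_triple_rotate[OF assms]]
    this[OF su2_triple_rotate[OF su2_triple_rotate[OF assms]]]
  show "\<beta> x y = 0" "\<beta> y z = 0" "\<beta> x z = 0" by (simp_all add: \<beta>_sym)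
qed

text \<open>With \<open>z = br x y\<close>, Jacobi shows that \<open>br y z\<close> commutes with
  \<open>x\<close>, so it equals \<open>k x\<close> by \<open>rank_one\<close>. Invariance gives
  \<open>k * \<beta> x x = \<beta> y y\<close>, so \<open>k > 0\<close>, and scaling
  \<open>y\<close> and \<open>z\<close> by \<open>1 / sqrt k\<close> normalises the triple.\<close>

lemma su2_tripleI:
  assumes x: "x \<in> H" and y: "y \<in> H" "y \<noteq> 0" and xxy: "br x (br x y) = - y"
  shows "\<exists>s>0. su2_triple x (s *\<^sub>R y) (s *\<^sub>R br x y)"
proof -
  define z where "z = br x y"
  have xz: "br x z = - y" by (simp add: z_def xxy)
  have x0: "x \<noteq> 0" using xxy y by (auto simp: brs)
  have "br x (br y z) = 0" using jacobi[of x y z] by (simp add: xz brs flip: z_def)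
  then obtain k where k: "br y z = k *\<^sub>R x" using rank_one[OF x x0, of "br y z"] by auto
  have "\<beta> (br y z) x = \<beta> y y" using \<beta>_inv[of y z x] br_anti[of z x] by (simp add: xz)
  then have "k * \<beta> x x = \<beta> y y" by (simp add: k \<beta>s)
  then have k0: "k > 0" using \<beta>_pos[OF x x0] \<beta>_pos[OF y] by (metis zero_less_mult_pos2)
  have "su2_triple x ((1 / sqrt k) *\<^sub>R y) ((1 / sqrt k) *\<^sub>R br x y)"
    using k0 br_anti[of z x] by (simp add: su2_triple_def brs k xz flip: z_def)
  then show ?thesis using k0 by (intro exI[of _ "1 / sqrt k"]) auto
qed

text \<open>A vector on which \<open>ad x\<close> has weight \<open>m\<close> is lowered to weight \<open>m - 1\<close>, so weights \<open>m \<ge> 1\<close>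
  cannot be minimal.\<close>

lemma no_large_weights:
  assumes tr: "su2_triple x y z"
    and W: "W = {w \<in> H. \<beta> x w = 0 \<and> \<beta> y w = 0 \<and> \<beta> z w = 0}"
    and min: "\<And>w. w \<in> W \<Longrightarrow> \<beta> (br x w) (br x w) \<ge> \<beta> w w"
  shows "W = {0}"
proof (rule ccontr)
  assume "W \<noteq> {0}"
  note b = su2_triple_br[OF tr]
  have W_sub: "subspace W" using subspace_H by (auto simp: W subspace_def \<beta>s)
  then have W_simps [simp]: "0 \<in> W" "v \<in> W \<Longrightarrow> w \<in> W \<Longrightarrow> v + w \<in> W"
    "v \<in> W \<Longrightarrow> w \<in> W \<Longrightarrow> v - w \<in> W" "v \<in> W \<Longrightarrow> k *\<^sub>R v \<in> W" for v w k
    by (auto intro: subspace_0 subspace_add subspace_diff subspace_scale)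
  have WH: "w \<in> W \<Longrightarrow> w \<in> H" for w by (simp add: W)
  \<comment> \<open>\<open>W\<close> is the orthogonal complement of a subalgebra for an invariant
    form.\<close>
  have W_inv [simp]: "br x w \<in> W" "br y w \<in> W" "br z w \<in> W" if "w \<in> W" for w
    using that by (auto simp: W b \<beta>s simp flip: \<beta>_inv)
  have nz: "\<exists>w\<in>W. w \<noteq> 0" using \<open>W \<noteq> {0}\<close> W_simps(1) by blast
  have sp: "W \<subseteq> span (e ` {..<n})" using H_span by (auto simp: W)
  have bil: "bilinear (\<lambda>v w. \<beta> (br x v) (br x w))"
    by (simp add: bilinear_def linear_iff brs \<beta>s)
  obtain w l where w: "w \<in> W" "w \<noteq> 0"
    "\<And>v. v \<in> W \<Longrightarrow> \<beta> (br x w) (br x v) = l * \<beta> w v"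
    "\<And>v. v \<in> W \<Longrightarrow> \<beta> (br x v) (br x v) \<ge> l * \<beta> v v"
    by (rule least_eigenvector[OF W_sub finite_imageI[OF finite_lessThan] sp nz \<beta>_bilinear \<beta>_sym _ bil])
      (use \<beta>_pos \<beta>_sym WH in auto)
  have "\<beta> w w > 0" using w \<beta>_pos WH by blast
  then have l: "l \<ge> 1" using w(3)[OF w(1)] min[OF w(1)] by simp
  have "br x (br x w) + l *\<^sub>R w \<in> W" using w by simp
  moreover have "\<beta> (br x (br x w) + l *\<^sub>R w) v = 0" if "v \<in> W" for v
    using \<beta>_skew[of x "br x w" v] w(3)[OF that] by (simp add: \<beta>s)
  ultimately have xxw: "br x (br x w) = - (l *\<^sub>R w)"
    using \<beta>_eq_0 WH by (metis add_eq_0_iff2)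
  \<comment> \<open>On the plane of \<open>w\<close> and \<open>w'\<close> the map
    \<open>ad x\<close> is rotation with speed \<open>m\<close>; over the complex numbers
    \<open>w + i w'\<close> is a weight vector.\<close>
  define m where "m = sqrt l"
  have m: "m \<ge> 1" "m * m = l" using l by (auto simp: m_def)
  define w' where "w' = (1 / m) *\<^sub>R br x w"
  have w': "w' \<in> W" "br x w = m *\<^sub>R w'" "br x w' = - (m *\<^sub>R w)"
    using w m by (auto simp: w'_def brs xxw)
  \<comment> \<open>Real and imaginary part of \<open>ad (y - i z)\<close> applied to
    \<open>w + i w'\<close>; this is the lowering operator, which explains the speed
    \<open>m - 1\<close> below.\<close>
  define u u' where "u = br y w + br z w'" and "u' = br y w' - br z w"
  have uW: "u \<in> W" "u' \<in> W" using w w' by (auto simp: u_def u'_def)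
  have xu: "br x u = (m - 1) *\<^sub>R u'"
    by (simp add: u_def u'_def brs b w' jacobi[of x y] jacobi[of x z] algebra_simps)
  have xu': "br x u' = - ((m - 1) *\<^sub>R u)"
    by (simp add: u_def u'_def brs b w' jacobi[of x y] jacobi[of x z] algebra_simps)
  have "\<beta> (br x u) (br x u) = (m - 1)\<^sup>2 * \<beta> u u"
    using \<beta>_skew[of x u "br x u"] by (simp add: xu xu' brs \<beta>s power2_eq_square)
  with w(4)[OF uW(1)] have "(m\<^sup>2 - (m - 1)\<^sup>2) * \<beta> u u \<le> 0"
    by (simp add: m(2)[symmetric] power2_eq_square algebra_simps)
  moreover have "m\<^sup>2 - (m - 1)\<^sup>2 > 0" using m(1) by (simp add: power2_eq_square algebra_simps)
  ultimately have "\<beta> u u \<le> 0" by (simp add: mult_le_0_iff)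
  then have u0: "u = 0" using \<beta>_pos[of u] WH uW by fastforce
  have "\<beta> u' u' \<le> 0" using w(4)[OF uW(2)] l by (simp add: xu' u0 \<beta>s mult_le_0_iff)
  then have u'0: "u' = 0" using \<beta>_pos[of u'] WH uW by fastforce
  \<comment> \<open>The lowering operator kills the weight vector. Writing \<open>ad x\<close> as
    the commutator of \<open>ad y\<close> and \<open>ad z\<close> then gives \<open>m w'\<close> as
    a sum of squares of skew maps applied to \<open>w'\<close>, which is negative
    semidefinite.\<close>
  have "m *\<^sub>R w' = br x w" by (simp add: w')
  also have "\<dots> = br y (br z w) - br z (br y w)"
    using jacobi[of y z w] by (simp add: b)
  also have "\<dots> = br y (br y w') + br z (br z w')"
    using u0 u'0 by (simp add: u_def u'_def add_eq_0_iff2 brs)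
  finally have "\<beta> (m *\<^sub>R w') w' = \<beta> (br y (br y w') + br z (br z w')) w'" by simp
  then have "m * \<beta> w' w' = - \<beta> (br y w') (br y w') - \<beta> (br z w') (br z w')"
    by (simp add: \<beta>s \<beta>_skew[of _ "br _ w'"])
  moreover have "w' \<noteq> 0" using w w' m by (auto simp: brs)
  ultimately show False
    using \<beta>_pos[of w'] w'(1) m WH \<beta>_nonneg[of "br y w'"] \<beta>_nonneg[of "br z w'"]
    by (smt (verit) br_in_H mult_pos_pos)
qed

lemma H_eq_span_triple:
  assumes "su2_triple x y z" and "{w \<in> H. \<beta> x w = 0 \<and> \<beta> y w = 0 \<and> \<beta> z w = 0} = {0}"
    and "x \<noteq> 0"
  shows "H = span {x, y, z}"
proof
  have in_H: "x \<in> H" "y \<in> H" "z \<in> H" using su2_triple_in_H[OF assms(1)] by auto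
  then show "span {x, y, z} \<subseteq> H" by (intro span_minimal subspace_H) auto
  have nz: "y \<noteq> 0" "z \<noteq> 0"
    using assms(3) su2_triple_br[OF assms(1)] by (auto simp: brs)
  note pos = \<beta>_pos[OF in_H(1) assms(3)] \<beta>_pos[OF in_H(2) nz(1)] \<beta>_pos[OF in_H(3) nz(2)]
  note o = su2_triple_\<beta>[OF assms(1)]
  show "H \<subseteq> span {x, y, z}"
  proof
    fix h assume h: "h \<in> H"
    define s where "s = (\<beta> x h / \<beta> x x) *\<^sub>R x + (\<beta> y h / \<beta> y y) *\<^sub>R y + (\<beta> z h / \<beta> z z) *\<^sub>R z"
    have "h - s \<in> {w \<in> H. \<beta> x w = 0 \<and> \<beta> y w = 0 \<and> \<beta> z w = 0}"
      using h in_H pos o o[unfolded \<beta>_sym[of x] \<beta>_sym[of y z]]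
      by (auto simp: s_def \<beta>s)
    then have "h = s" using assms(2) by simp
    also have "s \<in> span {x, y, z}"
      unfolding s_def by (intro span_add span_scale span_base) auto
    finally show "h \<in> span {x, y, z}" .
  qed
qed

text \<open>The least weight \<open>sqrt l\<close> of \<open>ad x0\<close> on the complement of
  \<open>x0\<close> is positive by \<open>rank_one\<close>. Dividing \<open>x0\<close> by it makes
  the least weight 1, which yields a triple and the hypothesis of \<open>no_large_weights\<close>.
  The vector \<open>x0\<close> is prescribed so that it can later be an eigenvector of the
  metric.\<close>

lemma H_line_or_triple:
  assumes x0: "x0 \<in> H" "x0 \<noteq> 0"
  shows "H = span {x0} \<or>
    (\<exists>m y z. m > 0 \<and> su2_triple ((1 / m) *\<^sub>R x0) y z \<and> H = span {(1 / m) *\<^sub>R x0, y, z})"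
proof -
  define E where "E = {w \<in> H. \<beta> x0 w = 0}"
  have E_sub: "subspace E" using subspace_H by (auto simp: E_def subspace_def \<beta>s)
  have EH: "w \<in> E \<Longrightarrow> w \<in> H" for w by (simp add: E_def)
  show ?thesis
  proof (cases "\<exists>w\<in>E. w \<noteq> 0")
    case False
    have "h \<in> span {x0}" if "h \<in> H" for h
    proof -
      have "h - (\<beta> x0 h / \<beta> x0 x0) *\<^sub>R x0 \<in> E"
        using that x0 \<beta>_pos[OF x0] by (auto simp: E_def \<beta>s)
      then have "h = (\<beta> x0 h / \<beta> x0 x0) *\<^sub>R x0" using False by (metis eq_iff_diff_eq_0)
      then show ?thesis by (metis span_base span_scale singletonI)
    qed
    moreover have "span {x0} \<subseteq> H" using x0 by (intro span_minimal subspace_H) auto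
    ultimately show ?thesis by blast
  next
    case True
    have sp: "E \<subseteq> span (e ` {..<n})" using H_span by (auto simp: E_def)
    have bil: "bilinear (\<lambda>v w. \<beta> (br x0 v) (br x0 w))"
      by (simp add: bilinear_def linear_iff brs \<beta>s)
    obtain y l where y: "y \<in> E" "y \<noteq> 0"
      "\<And>v. v \<in> E \<Longrightarrow> \<beta> (br x0 y) (br x0 v) = l * \<beta> y v"
      "\<And>v. v \<in> E \<Longrightarrow> \<beta> (br x0 v) (br x0 v) \<ge> l * \<beta> v v"
      by (rule least_eigenvector[OF E_sub finite_imageI[OF finite_lessThan] sp True \<beta>_bilinear \<beta>_sym _ bil])
        (use \<beta>_pos \<beta>_sym EH in auto)
    have "br x0 y \<noteq> 0"
    proof
      assume "br x0 y = 0"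
      then obtain k where "y = k *\<^sub>R x0" using rank_one[OF x0] y EH by blast
      then show False using y \<beta>_pos[OF x0] by (auto simp: E_def \<beta>s)
    qed
    then have "\<beta> (br x0 y) (br x0 y) > 0" by (simp add: \<beta>_pos)
    moreover have "\<beta> y y > 0" using y \<beta>_pos EH by blast
    ultimately have l: "l > 0" using y(3)[OF y(1)] by (simp add: zero_less_mult_iff)
    have brE: "br x0 w \<in> E" for w by (simp add: E_def \<beta>s flip: \<beta>_inv)
    then have "br x0 (br x0 y) + l *\<^sub>R y \<in> E"
      using y E_sub by (intro subspace_add subspace_scale)
    moreover have "\<beta> (br x0 (br x0 y) + l *\<^sub>R y) v = 0" if "v \<in> E" for v
      using \<beta>_skew[of x0 "br x0 y" v] y(3)[OF that] by (simp add: \<beta>s)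
    ultimately have xxy: "br x0 (br x0 y) = - (l *\<^sub>R y)"
      using \<beta>_eq_0 EH by (metis add_eq_0_iff2)
    define x where "x = (1 / sqrt l) *\<^sub>R x0"
    have xH: "x \<in> H" "x \<noteq> 0" using x0 l by (auto simp: x_def)
    have "br x (br x y) = - y" using l by (simp add: x_def brs xxy)
    then obtain s where "s > 0" and tr: "su2_triple x (s *\<^sub>R y) (s *\<^sub>R br x y)"
      using su2_tripleI xH y EH by blast
    have "{w \<in> H. \<beta> x w = 0 \<and> \<beta> (s *\<^sub>R y) w = 0 \<and> \<beta> (s *\<^sub>R br x y) w = 0} = {0}"
    proof (rule no_large_weights[OF tr refl])
      fix w assume "w \<in> {w \<in> H. \<beta> x w = 0 \<and> \<beta> (s *\<^sub>R y) w = 0 \<and> \<beta> (s *\<^sub>R br x y) w = 0}"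
      then have "w \<in> E" using l by (simp add: E_def x_def \<beta>s)
      from y(4)[OF this] show "\<beta> w w \<le> \<beta> (br x w) (br x w)"
        using l by (simp add: x_def brs \<beta>s field_simps)
    qed
    then have "H = span {x, s *\<^sub>R y, s *\<^sub>R br x y}" using H_eq_span_triple tr xH by blast
    then show ?thesis using tr l unfolding x_def by (metis real_sqrt_gt_zero)
  qed
qed

end

subsection \<open>The metric on the kernel of the Lee form\<close>

lemma in_span_three:
  "h \<in> span {x, y, z} \<longleftrightarrow> (\<exists>p q r. h = p *\<^sub>R x + q *\<^sub>R y + r *\<^sub>R z)"
proof
  assume "h \<in> span {x, y, z}"
  then obtain p q r where "h - p *\<^sub>R x - q *\<^sub>R y - r *\<^sub>R z = 0"
    by (auto simp: span_breakdown_eq)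
  then have "h = p *\<^sub>R x + q *\<^sub>R y + r *\<^sub>R z" by (simp add: algebra_simps)
  then show "\<exists>p q r. h = p *\<^sub>R x + q *\<^sub>R y + r *\<^sub>R z" by blast
qed (auto intro!: span_add span_scale intro: span_base)

text \<open>In terms of the half-sums \<open>P\<close>, \<open>Q\<close>, \<open>R\<close> the
  equations are linear in \<open>Q R\<close>, \<open>R P\<close>, \<open>P Q\<close>, and force all
  three products to equal \<open>N\<close>. As \<open>N\<close> is nonzero,
  \<open>P = Q = R\<close>, and \<open>P^2 = k a^3\<close> with \<open>a = 2 P\<close> gives
  \<open>a\<close>.\<close>

lemma milnor_equations_equal:
  fixes a b d k :: real
  assumes pos: "a > 0" "b > 0" "d > 0" "k > 0"
    and e1: "(b + d - a) * a / 2 = (d + a - b) / 2 * ((a + b - d) / 2) + k * a * b * d"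
    and e2: "(d + a - b) * b / 2 = (a + b - d) / 2 * ((b + d - a) / 2) + k * a * b * d"
    and e3: "(a + b - d) * d / 2 = (b + d - a) / 2 * ((d + a - b) / 2) + k * a * b * d"
  shows "a = b \<and> b = d \<and> a = 1 / (4 * k)"
proof -
  define P Q R where "P = (b + d - a) / 2" and "Q = (d + a - b) / 2" and "R = (a + b - d) / 2"
  define N where "N = k * a * b * d"
  have abd: "a = Q + R" "b = R + P" "d = P + Q" by (simp_all add: P_def Q_def R_def field_simps)
  have N: "N > 0" using pos by (simp add: N_def)
  have "P * (Q + R) = Q * R + N" "Q * (R + P) = R * P + N" "R * (P + Q) = P * Q + N"
    using e1 e2 e3 unfolding N_def by (simp_all add: P_def Q_def R_def field_simps)
  then have pr: "Q * R = N" "R * P = N" "P * Q = N" by (simp_all add: algebra_simps)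
  then have "P \<noteq> 0" "Q \<noteq> 0" "R \<noteq> 0" using N by auto
  with pr have "P = Q" "Q = R" by (metis mult.commute mult_cancel_left)+
  then have eq: "a = b" "b = d" "a = 2 * P" by (simp_all add: abd)
  have "P * P = k * a * a * a" using pr(3) eq(1,2) \<open>P = Q\<close> by (simp add: N_def)
  then have "a * a * (1 / 4 - k * a) = 0" using eq(3) by (simp add: algebra_simps)
  then have "1 / 4 = k * a" using pos by simp
  then show ?thesis using eq pos by (simp add: field_simps)
qed

context flat_similarity
begin

text \<open>A simultaneous diagonalisation of \<open>g\<close> and \<open>\<beta>\<close>: take one
  eigenvector \<open>x0\<close> of \<open>g\<close> relative to \<open>\<beta>\<close>, then a
  second one \<open>v\<close> in its complement. Since \<open>ad x\<close> rotates that complement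
  by a quarter turn, \<open>x\<close>, \<open>v\<close>, \<open>br x v\<close> is again a triple up
  to scaling, and its third member is the remaining eigenvector.\<close>

lemma milnor_frame:
  "H = {0} \<or> (\<exists>x. x \<noteq> 0 \<and> H = span {x}) \<or>
    (\<exists>x y z. su2_triple x y z \<and> x \<noteq> 0 \<and> H = span {x, y, z} \<and> g x y = 0 \<and> g y z = 0 \<and> g z x = 0)"
proof (cases "H = {0}")
  case False
  then have "\<exists>x\<in>H. x \<noteq> 0" using H_simps(1) by blast
  then obtain x0 l where x0: "x0 \<in> H" "x0 \<noteq> 0" "\<And>w. w \<in> H \<Longrightarrow> g x0 w = l * \<beta> x0 w"
    by (rule least_eigenvector[OF subspace_H finite_imageI[OF finite_lessThan] H_span _
        \<beta>_bilinear \<beta>_sym \<beta>_pos g_bilinear]) (use g_sym in auto)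
  show ?thesis
  proof (cases "H = span {x0}")
    case False
    then obtain m y z where m: "m > 0" and tr': "su2_triple ((1 / m) *\<^sub>R x0) y z"
      and sp': "H = span {(1 / m) *\<^sub>R x0, y, z}"
      using H_line_or_triple[OF x0(1,2)] by blast
    define x where "x = (1 / m) *\<^sub>R x0"
    have tr: "su2_triple x y z" and sp: "H = span {x, y, z}" and nz: "x \<noteq> 0"
      using tr' sp' m x0(2) by (simp_all add: x_def)
    note b = su2_triple_br[OF tr] and o = su2_triple_\<beta>[OF tr]
    have in_H: "x \<in> H" "y \<in> H" "z \<in> H" using su2_triple_in_H[OF tr] by auto
    have gx: "g x w = l * \<beta> x w" if "w \<in> H" for w
      using x0(3)[OF that] by (simp add: x_def gs \<beta>s)
    define E where "E = {w \<in> H. \<beta> x w = 0}"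
    have E: "subspace E" "E \<subseteq> span (e ` {..<n})"
      using subspace_H H_span by (auto simp: E_def subspace_def \<beta>s)
    have "y \<noteq> 0" using b nz by (auto simp: brs)
    then have "\<exists>w\<in>E. w \<noteq> 0" using in_H o by (auto simp: E_def)
    then obtain v k where v: "v \<in> E" "v \<noteq> 0" "\<And>w. w \<in> E \<Longrightarrow> g v w = k * \<beta> v w"
      by (rule least_eigenvector[OF E(1) finite_imageI[OF finite_lessThan] E(2) _
          \<beta>_bilinear \<beta>_sym _ g_bilinear]) (use g_sym \<beta>_pos in \<open>auto simp: E_def\<close>)
    have vH: "v \<in> H" "\<beta> x v = 0" using v(1) by (auto simp: E_def)
    then obtain p q r where pqr: "v = p *\<^sub>R x + q *\<^sub>R y + r *\<^sub>R z"
      using sp by (auto simp: in_span_three)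
    have "p = 0" using vH(2) \<beta>_pos[OF in_H(1) nz] by (simp add: pqr \<beta>s o)
    then have v_eq: "v = q *\<^sub>R y + r *\<^sub>R z" by (simp add: pqr)
    have xv: "br x v = q *\<^sub>R z - r *\<^sub>R y" by (simp add: v_eq brs b)
    have "br x (br x v) = - v" by (simp add: xv) (simp add: v_eq brs b)
    then obtain s where s: "s > 0" and tr2: "su2_triple x (s *\<^sub>R v) (s *\<^sub>R br x v)"
      using su2_tripleI in_H(1) vH(1) v(2) by blast
    note o2 = su2_triple_\<beta>[OF tr2]
    have in_H2: "s *\<^sub>R v \<in> H" "s *\<^sub>R br x v \<in> H" using su2_triple_in_H[OF tr2] by auto
    have N: "q * q + r * r \<noteq> 0"
      using v(2) by (auto simp: v_eq sum_squares_eq_zero_iff)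
    let ?S = "span {x, s *\<^sub>R v, s *\<^sub>R br x v}"
    have vS: "v \<in> ?S" "br x v \<in> ?S"
    proof -
      have "(1 / s) *\<^sub>R (s *\<^sub>R v) \<in> ?S" "(1 / s) *\<^sub>R (s *\<^sub>R br x v) \<in> ?S"
        by (intro span_scale span_base; simp)+
      then show "v \<in> ?S" "br x v \<in> ?S" using s by simp_all
    qed
    \<comment> \<open>Inverting the rotation and dilation that takes \<open>y\<close>,
      \<open>z\<close> to \<open>v\<close>, \<open>br x v\<close>.\<close>
    have "(q * q + r * r) *\<^sub>R y = q *\<^sub>R v - r *\<^sub>R br x v"
      "(q * q + r * r) *\<^sub>R z = r *\<^sub>R v + q *\<^sub>R br x v"
      by (simp_all only: xv) (simp_all add: v_eq algebra_simps)
    then have S: "(q * q + r * r) *\<^sub>R y \<in> ?S" "(q * q + r * r) *\<^sub>R z \<in> ?S"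
      using vS by (simp_all add: span_add span_diff span_scale)
    then have "y \<in> ?S" "z \<in> ?S"
      using span_scale[OF S(1), of "1 / (q * q + r * r)"] span_scale[OF S(2), of "1 / (q * q + r * r)"] N
      by (auto split: if_splits)
    moreover have "x \<in> ?S" by (simp add: span_base)
    ultimately have "H \<subseteq> ?S" unfolding sp by (intro span_minimal) auto
    moreover have "?S \<subseteq> H" using in_H in_H2 by (intro span_minimal subspace_H) auto
    moreover have "g x (s *\<^sub>R v) = 0" "g (s *\<^sub>R br x v) x = 0"
      using gx[OF in_H2(1)] gx[OF in_H2(2)] o2 g_sym by simp_all
    moreover have "g (s *\<^sub>R v) (s *\<^sub>R br x v) = 0"
      using v(3)[of "s *\<^sub>R br x v"] in_H2 o2 by (auto simp: E_def gs \<beta>s)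
    ultimately show ?thesis using tr2 nz by blast
  qed (use x0 in blast)
qed simp

text \<open>Elements of \<open>H\<close> act by skew maps and \<open>D\<close> is torsion-free, so
  the part of \<open>D\<close> tangent to \<open>H\<close> is the Levi-Civita connection of
  \<open>H\<close>.\<close>

lemma koszul:
  assumes "p \<in> H" "q \<in> H" "r \<in> H"
  shows "2 * g (D p q) r = g (br p q) r - g (br p r) q - g (br q r) p"
  using skew[OF assms(1), of q r] skew[OF assms(1), of r q] skew[OF assms(2), of p r]
    skew[OF assms(2), of r p] skew[OF assms(3), of p q] skew[OF assms(3), of q p]
    g_sym[of p "D q r"] g_sym[of p "D r q"] g_sym[of q "D p r"] g_sym[of q "D r p"]
  by (simp add: br_eq gs)

lemma frame_expansion:
  assumes tr: "su2_triple x y z" and nz: "x \<noteq> 0" and sp: "H = span {x, y, z}"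
    and o: "g x y = 0" "g y z = 0" "g z x = 0" and v: "v \<in> V"
  shows "v = (g v t / c) *\<^sub>R t + (g v x / g x x) *\<^sub>R x + (g v y / g y y) *\<^sub>R y + (g v z / g z z) *\<^sub>R z"
proof -
  have in_H: "x \<in> H" "y \<in> H" "z \<in> H" using su2_triple_in_H[OF tr] by auto
  then have gt: "g t x = 0" "g t y = 0" "g t z = 0" by (auto simp: H_def)
  have "y \<noteq> 0" "z \<noteq> 0" using su2_triple_br[OF tr] nz by (auto simp: brs)
  with nz have pos: "g x x \<noteq> 0" "g y y \<noteq> 0" "g z z \<noteq> 0"
    using g_eq_0 in_H H_V by auto
  have "v - (g v t / c) *\<^sub>R t \<in> H"
    using v c_pos by (simp add: H_def gs g_sym[of t v] flip: c_def)
  then obtain p q r where "v - (g v t / c) *\<^sub>R t = p *\<^sub>R x + q *\<^sub>R y + r *\<^sub>R z"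
    using sp by (auto simp: in_span_three)
  then have ve: "v = (g v t / c) *\<^sub>R t + p *\<^sub>R x + q *\<^sub>R y + r *\<^sub>R z" by (simp add: algebra_simps)
  have "g v x = p * g x x" "g v y = q * g y y" "g v z = r * g z z"
    by (subst ve, simp add: gs o gt g_sym[of y x] g_sym[of z y] g_sym[of x z])+
  then show ?thesis using ve pos by simp
qed

text \<open>A Gauss equation: one component of flatness says that the plane of \<open>x\<close> and
  \<open>y\<close> has curvature \<open>c\<close>. The two other planes are obtained by rotating the
  triple.\<close>

lemma milnor_equation:
  assumes tr: "su2_triple x y z" and nz: "x \<noteq> 0" and sp: "H = span {x, y, z}"
    and o: "g x y = 0" "g y z = 0" "g z x = 0"
  shows "(g x x + g y y - g z z) * g z z / 2
    = (g y y + g z z - g x x) / 2 * ((g z z + g x x - g y y) / 2) + c * g x x * g y y * g z z"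
proof -
  have in_H: "x \<in> H" "y \<in> H" "z \<in> H" using su2_triple_in_H[OF tr] by auto
  note b = su2_triple_br[OF tr] and k = koszul[OF in_H(1)] koszul[OF in_H(2)] koszul[OF in_H(3)]
  have o': "g y x = 0" "g z y = 0" "g x z = 0" using o g_sym by auto
  have "y \<noteq> 0" "z \<noteq> 0" using b nz by (auto simp: brs)
  with nz have pos: "g x x \<noteq> 0" "g y y \<noteq> 0" "g z z \<noteq> 0"
    using g_eq_0 in_H H_V by auto
  \<comment> \<open>The second fundamental form of \<open>H\<close>, pure because \<open>R t\<close>
    is multiplication by \<open>c\<close>.\<close>
  have Dt: "g (D p q) t = - c * g q p" if "p \<in> H" for p q
    using skew[OF that, of q t] R_t[OF H_V[OF that]] by (simp add: gs)
  note cmp = k[OF in_H(1) in_H(1)] k[OF in_H(1) in_H(2)] k[OF in_H(1) in_H(3)]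
    k[OF in_H(2) in_H(1)] k[OF in_H(2) in_H(2)] k[OF in_H(2) in_H(3)]
    k[OF in_H(3) in_H(1)] k[OF in_H(3) in_H(2)] k[OF in_H(3) in_H(3)]
  have Dyx: "g (D y x) x = 0" "g (D y x) y = 0" "g (D y x) z = (g y y - g z z - g x x) / 2"
    and Dxy: "g (D x y) z = (g z z + g y y - g x x) / 2"
    and Dzx: "g (D z x) y = (g y y + g x x - g z z) / 2"
    and Dxx: "g (D x x) x = 0" "g (D x x) y = 0" "g (D x x) z = 0"
    using cmp by (simp_all add: b brs gs o o')
  have Dyy: "g (D y y) t = - c * g y y" "g (D y y) x = 0" "g (D y y) y = 0" "g (D y y) z = 0"
    using cmp by (simp_all add: b brs gs o o' Dt in_H)
  have Dt': "g (D y x) t = 0" "g (D x x) t = - c * g x x" by (simp_all add: Dt in_H o)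
  note ex = frame_expansion[OF tr nz sp o]
  have yx: "D y x = (g (D y x) z / g z z) *\<^sub>R z"
    by (rule trans[OF ex]) (simp_all add: Dyx Dt')
  have xx: "D x x = - g x x *\<^sub>R t"
    by (rule trans[OF ex]) (use c_pos in \<open>simp_all add: Dxx Dt'\<close>)
  have "g (D z x) y = g (D x (D y x)) y - g (D y (D x x)) y"
    using flat[of x y x] by (simp add: b gs)
  also have "\<dots> = - g (D y x) (D x y) + g (D x x) (D y y)"
    by (simp add: skew in_H)
  also have "\<dots> = - (g (D y x) z / g z z) * g (D x y) z + c * g x x * g y y"
    by (subst yx, subst xx) (simp add: gs Dyy g_sym[of t] g_sym[of z "D x y"])
  finally have "(g y y + g x x - g z z) / 2 * g z z = (g z z + g x x - g y y) / 2 * ((g z z + g y y - g x x) / 2)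
      + c * g x x * g y y * g z z"
    using pos by (simp add: Dyx Dxy Dzx field_simps)
  then show ?thesis by (simp add: algebra_simps)
qed

lemma orthogonal_triple_norm:
  assumes tr: "su2_triple x y z" and nz: "x \<noteq> 0" and sp: "H = span {x, y, z}"
    and o: "g x y = 0" "g y z = 0" "g z x = 0"
  shows "g x x = 1 / (4 * c)" "g y y = 1 / (4 * c)" "g z z = 1 / (4 * c)"
proof -
  have in_H: "x \<in> H" "y \<in> H" "z \<in> H" using su2_triple_in_H[OF tr] by auto
  have nz': "y \<noteq> 0" "z \<noteq> 0" using su2_triple_br[OF tr] nz by (auto simp: brs)
  have pos: "g x x > 0" "g y y > 0" "g z z > 0" using g_pos in_H H_V nz nz' by auto
  have perm: "{y, z, x} = {x, y, z}" "{z, x, y} = {x, y, z}" by auto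
  note tr' = su2_triple_rotate[OF tr] note tr'' = su2_triple_rotate[OF tr']
  have "g x x = g y y \<and> g y y = g z z \<and> g x x = 1 / (4 * c)"
    using milnor_equation[OF tr nz sp o] milnor_equation[OF tr' nz'(1) _ o(2,3,1)]
      milnor_equation[OF tr'' nz'(2) _ o(3,1,2)] sp perm
    by (intro milnor_equations_equal pos c_pos) (simp_all add: ac_simps)
  then show "g x x = 1 / (4 * c)" "g y y = 1 / (4 * c)" "g z z = 1 / (4 * c)" by auto
qed

text \<open>One orthogonal triple shows that \<open>g\<close> on \<open>H\<close> is invariant under
  the adjoint action; invariance makes every other triple orthogonal, and the norms follow again. An
  arbitrary isomorphism supplies an arbitrary triple, hence this generality.\<close>

lemma su2_triple_metric:
  assumes tr: "su2_triple x y z" and nz: "x \<noteq> 0" and sp: "H = span {x, y, z}"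
  shows "g x y = 0" "g y z = 0" "g z x = 0"
    and "g x x = 1 / (4 * c)" "g y y = 1 / (4 * c)" "g z z = 1 / (4 * c)"
proof -
  have in_H: "x \<in> H" "y \<in> H" "z \<in> H" using su2_triple_in_H[OF tr] by auto
  have "z \<noteq> 0" using su2_triple_br[OF tr] nz by (auto simp: brs)
  have "H \<noteq> {0}" using in_H nz by blast
  moreover have "H \<noteq> span {a}" for a
  proof
    assume "H = span {a}"
    then have "br x y = 0" using in_H by (auto simp: span_singleton brs)
    then show False using su2_triple_br[OF tr] \<open>z \<noteq> 0\<close> by simp
  qed
  ultimately obtain x1 y1 z1 where f: "su2_triple x1 y1 z1" "x1 \<noteq> 0" "H = span {x1, y1, z1}"
    "g x1 y1 = 0" "g y1 z1 = 0" "g z1 x1 = 0"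
    using milnor_frame by blast
  note b = su2_triple_br[OF f(1)] and N = orthogonal_triple_norm[OF f]
  have "g y1 x1 = 0" "g z1 y1 = 0" "g x1 z1 = 0" using f g_sym by auto
  then have inv: "g (br u v) w = g u (br v w)" if "u \<in> H" "v \<in> H" "w \<in> H" for u v w
    using that unfolding f(3) in_span_three
    by (elim exE) (simp add: brs gs b f(4-6) N algebra_simps)
  have o: "g x y = 0" if "su2_triple x y z" for x y z
    using inv[of x x z] su2_triple_br[OF that] su2_triple_in_H[OF that] by (simp add: gs)
  from o[OF tr] o[OF su2_triple_rotate[OF tr]] o[OF su2_triple_rotate[OF su2_triple_rotate[OF tr]]]
  show ort: "g x y = 0" "g y z = 0" "g z x = 0" .
  from orthogonal_triple_norm[OF assms ort]
  show "g x x = 1 / (4 * c)" "g y y = 1 / (4 * c)" "g z z = 1 / (4 * c)" .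
qed

text \<open>The symmetric part of \<open>D t\<close> is \<open>c\<close> times the identity, exactly
  what \<open>D u t = c u\<close> subtracts.\<close>

lemma ad_t_skew: "u \<in> H \<Longrightarrow> v \<in> H \<Longrightarrow> g (br t u) v = - g u (br t v)"
  using weyl[of t u v] by (simp add: br_eq gs R_t H_V flip: c_def)

lemma V_decomp: "v \<in> V \<Longrightarrow> v - (g v t / c) *\<^sub>R t \<in> H"
  using c_pos by (simp add: H_def gs g_sym[of t v] flip: c_def)

lemma ad_t_inner:
  assumes tr: "su2_triple x y z" and nz: "x \<noteq> 0" and sp: "H = span {x, y, z}"
  obtains s where "s \<in> H" "\<And>v. v \<in> V \<Longrightarrow> br (t - s) v = 0"
proof -
  note b = su2_triple_br[OF tr] and m = su2_triple_metric[OF assms]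
  have in_H: "x \<in> H" "y \<in> H" "z \<in> H" using su2_triple_in_H[OF tr] by auto
  have m': "g y x = 0" "g z y = 0" "g x z = 0" using m g_sym by auto
  \<comment> \<open>Skew maps in dimension three are cross products: these are the matrix entries of
    \<open>ad t\<close>, and \<open>s\<close> is the axis vector. The factor \<open>4 * c\<close> is
    the inverse square length of the triple.\<close>
  define p q r where "p = 4 * c * g (br t x) y" and "q = 4 * c * g (br t y) z"
    and "r = 4 * c * g (br t z) x"
  define s where "s = q *\<^sub>R x + r *\<^sub>R y + p *\<^sub>R z"
  have sH: "s \<in> H" using in_H by (simp add: s_def)
  have ex: "u = (4 * c * g u x) *\<^sub>R x + (4 * c * g u y) *\<^sub>R y + (4 * c * g u z) *\<^sub>R z" if "u \<in> H" for u
  proof -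
    have "g u t = 0" using that g_sym by (simp add: H_def)
    then show ?thesis
      using frame_expansion[OF assms m(1-3) H_V[OF that]] m(4-6) by (simp add: mult.commute)
  qed
  have sk: "g (br t u) u = 0" if "u \<in> H" for u
    using ad_t_skew[OF that that] g_sym[of u "br t u"] by simp
  have sk': "g (br t y) x = - g (br t x) y" "g (br t z) y = - g (br t y) z"
    "g (br t x) z = - g (br t z) x"
    using ad_t_skew[OF in_H(2,1)] ad_t_skew[OF in_H(3,2)] ad_t_skew[OF in_H(1,3)] g_sym by auto
  have tx: "br t x = br s x"
    by (rule trans[OF ex[OF br_in_H]]) (simp add: s_def brs b sk sk' in_H p_def r_def)
  have ty: "br t y = br s y"
    by (rule trans[OF ex[OF br_in_H]]) (simp add: s_def brs b sk sk' in_H p_def q_def)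
  have tz: "br t z = br s z"
    by (rule trans[OF ex[OF br_in_H]]) (simp add: s_def brs b sk sk' in_H q_def r_def)
  have H0: "br (t - s) h = 0" if "h \<in> H" for h
    using that unfolding sp in_span_three by (auto simp: brs tx ty tz)
  \<comment> \<open>Up to sign this is \<open>br s t\<close>, and \<open>br (t - s) s = 0\<close>
    already says that it vanishes.\<close>
  have "br (t - s) t = 0"
    using H0[OF sH] br_anti[of s t] by (simp add: brs)
  then have "br (t - s) v = 0" if "v \<in> V" for v
    using H0[OF V_decomp[OF that]] by (simp add: brs)
  then show ?thesis using that[of s] sH by blast
qed

lemma ad_t_line:
  assumes "H = span {x}"
  shows "br t x = 0"
proof -
  have x: "x \<in> H" by (simp add: assms span_base)
  have "br t x \<in> H" by simp
  then obtain k where k: "br t x = k *\<^sub>R x" unfolding assms span_singleton by auto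
  have "g (br t x) x = 0" using ad_t_skew[OF x x] g_sym[of x "br t x"] by simp
  then have "k = 0 \<or> x = 0" using g_eq_0[of x] x by (auto simp: k gs H_V)
  then show ?thesis using k by auto
qed

end

subsection \<open>The Lie algebra su(2)\<close>

no_notation Matrix.vec_index (infixl "$" 100)

lemma linear_between_inj_on:
  assumes "subspace V" "linear_between V W f" "\<And>x. x \<in> V \<Longrightarrow> f x = 0 \<Longrightarrow> x = 0"
  shows "inj_on f V"
proof (rule inj_onI)
  fix x y assume xy: "x \<in> V" "y \<in> V" "f x = f y"
  have m: "(- 1) *\<^sub>R y \<in> V" using xy assms(1) by (intro subspace_scale)
  then have "f (x + (- 1) *\<^sub>R y) = f x + (- 1) *\<^sub>R f y"
    using xy assms(2) unfolding linear_between_def by metis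
  then have "f (x + (- 1) *\<^sub>R y) = 0" using xy by simp
  then have "x + (- 1) *\<^sub>R y = 0" using assms(1) xy m by (intro assms(3) subspace_add)
  then show "x = y" by simp
qed

lemma inner_product_on_pullback:
  assumes \<phi>: "linear_between W V \<phi>" "inj_on \<phi> W" and W: "subspace W" and g: "inner_product_on V g"
  shows "inner_product_on W (\<lambda>x y. g (\<phi> x) (\<phi> y))"
proof -
  have "\<phi> x \<noteq> 0" if "x \<in> W" "x \<noteq> 0" for x
    using inj_onD[OF \<phi>(2), of x 0] that subspace_0[OF W] linear_between_0[OF _ \<phi>(1)] by auto
  then show ?thesis
    using \<phi>(1) g by (auto simp: inner_product_on_def bilinear_between_def linear_between_def)
qed

lemma nonzero_one_form_pullback:
  assumes "linear_between W V \<phi>" "\<phi> ` W = V" "nonzero_one_form V \<theta>"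
  shows "nonzero_one_form W (\<lambda>x. \<theta> (\<phi> x))"
  using assms by (auto simp: nonzero_one_form_def linear_between_def)

lemma lie_isomorphism_cong:
  assumes "\<And>x y. x \<in> V \<Longrightarrow> y \<in> V \<Longrightarrow> br x y = br' x y"
  shows "lie_isomorphism W brW V br \<phi> \<longleftrightarrow> lie_isomorphism W brW V br' \<phi>"
  using assms by (auto simp: lie_isomorphism_def linear_between_def)

text \<open>The basis is normalised so that the bracket becomes the cross product.\<close>

definition su2_matrix :: "real \<Rightarrow> real \<Rightarrow> real \<Rightarrow> complex^2^2" where
  "su2_matrix p q r = vector [vector [Complex 0 (p/2), Complex (q/2) (r/2)],
     vector [Complex (- q/2) (r/2), Complex 0 (- p/2)]]"

definition su2_coord :: "nat \<Rightarrow> complex^2^2 \<Rightarrow> real" where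
  "su2_coord i A = (if i = 0 then 2 * Im (A $ 1 $ 1) else if i = 1 then 2 * Re (A $ 1 $ 2) else 2 * Im (A $ 1 $ 2))"

lemma su2_coord_matrix [simp]:
  "su2_coord 0 (su2_matrix p q r) = p" "su2_coord 1 (su2_matrix p q r) = q"
  "su2_coord (Suc 0) (su2_matrix p q r) = q" "su2_coord 2 (su2_matrix p q r) = r"
  by (simp_all add: su2_coord_def su2_matrix_def)

lemma su2_matrix_in [simp]: "su2_matrix p q r \<in> su2"
  by (simp add: su2_def su2_matrix_def forall_2 trace_def sum_2 complex_eq_iff)

lemma su2_eq_matrix:
  assumes "A \<in> su2"
  shows "A = su2_matrix (su2_coord 0 A) (su2_coord 1 A) (su2_coord 2 A)"
proof -
  have h: "A $ j $ i = - cnj (A $ i $ j)" for i j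
    using assms unfolding su2_def by blast
  have "trace A = 0" using assms unfolding su2_def by blast
  then have "A $ 1 $ 1 + A $ 2 $ 2 = 0" by (simp add: trace_def sum_2)
  then have "Re (A $ 1 $ 1) = 0 \<and> Re (A $ 2 $ 2) = 0 \<and> Im (A $ 2 $ 2) = - Im (A $ 1 $ 1) \<and>
    Re (A $ 2 $ 1) = - Re (A $ 1 $ 2) \<and> Im (A $ 2 $ 1) = Im (A $ 1 $ 2)"
    using h[of 1 1] h[of 2 2] h[of 2 1]
    unfolding complex_eq_iff plus_complex.sel uminus_complex.sel cnj.sel zero_complex.sel
    by linarith
  then show ?thesis
    by (simp add: su2_matrix_def su2_coord_def Finite_Cartesian_Product.vec_eq_iff forall_2 complex_eq_iff)
qed

lemma su2_matrix_add: "su2_matrix p q r + su2_matrix p' q' r' = su2_matrix (p + p') (q + q') (r + r')"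
  and su2_matrix_scale: "k *\<^sub>R su2_matrix p q r = su2_matrix (k * p) (k * q) (k * r)"
  and su2_matrix_0: "su2_matrix 0 0 0 = 0"
  by (simp_all add: su2_matrix_def Finite_Cartesian_Product.vec_eq_iff forall_2 complex_eq_iff add_divide_distrib)

lemma commutator_su2_matrix:
  "commutator (su2_matrix p q r) (su2_matrix p' q' r')
    = su2_matrix (q * r' - r * q') (r * p' - p * r') (p * q' - q * p')"
  by (simp add: commutator_def su2_matrix_def Finite_Cartesian_Product.vec_eq_iff forall_2 matrix_matrix_mult_def sum_2
      complex_eq_iff field_simps)

lemma subspace_su2: "subspace su2"
proof -
  have "x + y \<in> su2" "k *\<^sub>R x \<in> su2" if "x \<in> su2" "y \<in> su2" for x y k
    by (subst su2_eq_matrix[OF that(1)], (subst su2_eq_matrix[OF that(2)])?,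
        simp add: su2_matrix_add su2_matrix_scale)+
  moreover have "0 \<in> su2" using su2_matrix_in[of 0 0 0] by (simp only: su2_matrix_0)
  ultimately show ?thesis by (auto simp: subspace_def)
qed

lemma linear_su2_coord: "linear (su2_coord i)"
  by (intro linearI) (auto simp: su2_coord_def)

lemma commutator_in_su2: "A \<in> su2 \<Longrightarrow> B \<in> su2 \<Longrightarrow> commutator A B \<in> su2"
  by (subst su2_eq_matrix[of A], assumption, subst su2_eq_matrix[of B], assumption)
    (simp add: commutator_su2_matrix)

lemma linear_commutator: "linear (commutator A)"
  by (intro linearI) (simp_all add: commutator_def matrix_matrix_mult_def sum_2
      Finite_Cartesian_Product.vec_eq_iff algebra_simps)

text \<open>The bracket is the cross product, and \<open>A x (B x v) = (A . v) B - (A . B) v\<close>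
  has trace \<open>A . B - 3 A . B\<close>, whence the factor -2.\<close>

lemma killing_form_su2:
  assumes "A \<in> su2" "B \<in> su2"
  shows "killing_form su2 commutator A B = - 2 * (su2_coord 0 A * su2_coord 0 B
    + su2_coord 1 A * su2_coord 1 B + su2_coord 2 A * su2_coord 2 B)"
proof -
  define e where "e i = su2_matrix (if i = 0 then 1 else 0) (if i = 1 then 1 else 0)
    (if i = 2 then 1 else 0)" for i :: nat
  obtain p q r p' q' r' where AB: "A = su2_matrix p q r" "B = su2_matrix p' q' r'"
    using su2_eq_matrix assms by metis
  have ex: "x = (\<Sum>i<3. su2_coord i x *\<^sub>R e i)" if "x \<in> su2" for x
    by (rule trans[OF su2_eq_matrix[OF that]])
      (simp add: e_def numeral_3_eq_3 numeral_2_eq_2 lessThan_Suc su2_matrix_add su2_matrix_scale)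
  have sp: "span (e ` {..<3}) = su2"
  proof
    show "span (e ` {..<3}) \<subseteq> su2" by (intro span_minimal subspace_su2) (auto simp: e_def)
    show "su2 \<subseteq> span (e ` {..<3})"
    proof
      fix x :: "complex^2^2" assume "x \<in> su2"
      then have "x = (\<Sum>i<3. su2_coord i x *\<^sub>R e i)" by (rule ex)
      also have "\<dots> \<in> span (e ` {..<3})" by (intro span_sum span_scale span_base) auto
      finally show "x \<in> span (e ` {..<3})" .
    qed
  qed
  have lin: "linear_between su2 su2 (commutator A \<circ> commutator B)"
    using assms commutator_in_su2
    by (auto simp: linear_between_def linear_add[OF linear_commutator] linear_cmul[OF linear_commutator])
  have "endo_trace su2 (commutator A \<circ> commutator B)
      = (\<Sum>i<3. su2_coord i ((commutator A \<circ> commutator B) (e i)))"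
  proof (rule endo_trace_coordinates[OF subspace_su2 _ sp lin])
    show "linear_between su2 UNIV (su2_coord i)" for i
      using linear_su2_coord by (simp add: linear_between_def linear_add linear_cmul)
    show "finite (e ` {..<3})" by simp
    show "e i \<in> su2" for i by (simp add: e_def)
    show "x = (\<Sum>i<3. su2_coord i x *\<^sub>R e i)" if "x \<in> su2" for x using that by (rule ex)
  qed
  also have "\<dots> = su2_coord 0 (commutator A (commutator B (su2_matrix 1 0 0)))
      + su2_coord 1 (commutator A (commutator B (su2_matrix 0 1 0)))
      + su2_coord 2 (commutator A (commutator B (su2_matrix 0 0 1)))"
    by (simp add: numeral_3_eq_3 numeral_2_eq_2 lessThan_Suc e_def)
  finally show ?thesis
    by (simp add: killing_form_def AB commutator_su2_matrix algebra_simps)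
qed

subsection \<open>The classification\<close>

context flat_similarity
begin

lemma lie_isomorphismI:
  assumes W: "subspace W" and lin: "linear_between W V \<phi>"
    and ker: "\<And>w. w \<in> W \<Longrightarrow> \<phi> w = 0 \<Longrightarrow> w = 0"
    and sur: "\<And>v. v \<in> V \<Longrightarrow> \<exists>w\<in>W. \<phi> w = v"
    and br: "\<And>w w'. w \<in> W \<Longrightarrow> w' \<in> W \<Longrightarrow> \<phi> (brW w w') = br (\<phi> w) (\<phi> w')"
  shows "lie_isomorphism W brW V br \<phi>"
proof -
  have "\<phi> ` W = V" using lin sur by (auto simp: linear_between_def image_iff Bex_def)
  then show ?thesis
    using linear_between_inj_on[OF W lin ker] lin br by (auto simp: lie_isomorphism_def bij_betw_def)
qed

lemma isomorphic_R1:
  assumes "H = {0}"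
  shows "lie_isomorphic (UNIV :: (real^1) set) abelian_bracket V br"
proof -
  have "lie_isomorphism (UNIV :: (real^1) set) abelian_bracket V br (\<lambda>a. a $ 1 *\<^sub>R t)"
  proof (rule lie_isomorphismI)
    show "\<exists>w\<in>UNIV. (w :: real^1) $ 1 *\<^sub>R t = v" if "v \<in> V" for v
      using V_decomp[OF that] assms
      by (intro bexI[of _ "\<chi> i. g v t / c"]) auto
  qed (auto simp: linear_between_def algebra_simps t_nz brs abelian_bracket_def
      Finite_Cartesian_Product.vec_eq_iff)
  then show ?thesis by (auto simp: lie_isomorphic_def)
qed

lemma isomorphic_R2:
  assumes "H = span {x}" "x \<noteq> 0"
  shows "lie_isomorphic (UNIV :: (real^2) set) abelian_bracket V br"
proof -
  have xH: "x \<in> H" by (simp add: assms(1) span_base)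
  then have x: "x \<in> V" "g t x = 0" by (auto simp: H_def)
  have tx: "br t x = 0" "br x t = 0" using ad_t_line[OF assms(1)] br_anti[of x t] by auto
  have "lie_isomorphism (UNIV :: (real^2) set) abelian_bracket V br (\<lambda>a. a $ 1 *\<^sub>R t + a $ 2 *\<^sub>R x)"
  proof (rule lie_isomorphismI)
    fix v assume "v \<in> V"
    then obtain k where "v - (g v t / c) *\<^sub>R t = k *\<^sub>R x"
      using V_decomp assms(1) by (auto simp: span_singleton)
    then show "\<exists>w\<in>UNIV. (w :: real^2) $ 1 *\<^sub>R t + w $ 2 *\<^sub>R x = v"
      by (intro bexI[of _ "vector [g v t / c, k]"]) (auto simp: algebra_simps)
  next
    fix w :: "real^2" assume w: "w $ 1 *\<^sub>R t + w $ 2 *\<^sub>R x = 0"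
    have "g t (w $ 1 *\<^sub>R t + w $ 2 *\<^sub>R x) = w $ 1 * c" by (simp add: gs x c_def)
    then have "w $ 1 = 0" using c_pos by (simp add: w gs)
    then show "w = 0" using w assms(2) by (simp add: Finite_Cartesian_Product.vec_eq_iff forall_2)
  qed (auto simp: linear_between_def algebra_simps brs tx x abelian_bracket_def)
  then show ?thesis by (auto simp: lie_isomorphic_def)
qed

text \<open>The \<open>su2\<close> factor goes to \<open>H\<close> along the triple, the line to the
  central element \<open>t - s\<close>, which is transverse to \<open>H\<close>.\<close>

lemma isomorphic_su2_R:
  assumes tr: "su2_triple x y z" and nz: "x \<noteq> 0" and sp: "H = span {x, y, z}"
  shows "lie_isomorphic su2_R su2_R_bracket V br"
proof -
  have in_H: "x \<in> H" "y \<in> H" "z \<in> H" using su2_triple_in_H[OF tr] by auto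
  note b = su2_triple_br[OF tr] and m = su2_triple_metric[OF assms]
  have m': "g y x = 0" "g z y = 0" "g x z = 0" using m g_sym by auto
  obtain s where s: "s \<in> H" and cen: "\<And>v. v \<in> V \<Longrightarrow> br (t - s) v = 0"
    using ad_t_inner[OF assms] by blast
  define z0 where "z0 = t - s"
  have z0: "z0 \<in> V" "g t z0 = c" using s by (auto simp: z0_def gs c_def H_def)
  have bz: "br z0 v = 0" "br v z0 = 0" if "v \<in> V" for v
    using cen[OF that] br_anti[of v z0] by (simp_all add: z0_def)
  define F where "F A = su2_coord 0 A *\<^sub>R x + su2_coord 1 A *\<^sub>R y + su2_coord 2 A *\<^sub>R z" for A
  have F_lin: "F (A + B) = F A + F B" "F (k *\<^sub>R A) = k *\<^sub>R F A" for A B k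
    by (simp_all add: F_def linear_add[OF linear_su2_coord] linear_cmul[OF linear_su2_coord] algebra_simps)
  have F_H: "F A \<in> H" for A using in_H by (simp add: F_def)
  have "lie_isomorphism su2_R su2_R_bracket V br (\<lambda>w. F (fst w) + snd w *\<^sub>R z0)"
  proof (rule lie_isomorphismI)
    show "subspace su2_R"
      unfolding su2_R_def by (intro subspace_Times subspace_su2 subspace_UNIV)
    show "linear_between su2_R V (\<lambda>w. F (fst w) + snd w *\<^sub>R z0)"
      using F_H z0 by (auto simp: linear_between_def F_lin H_V algebra_simps)
  next
    fix w assume w: "w \<in> su2_R" "F (fst w) + snd w *\<^sub>R z0 = 0"
    \<comment> \<open>The image of \<open>F\<close> is orthogonal to \<open>t\<close>, so pairing
      with \<open>t\<close> isolates the central coordinate.\<close>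
    have "g t (F (fst w) + snd w *\<^sub>R z0) = snd w * c"
      using F_H[of "fst w"] by (simp add: gs z0 H_def)
    then have s0: "snd w = 0" using c_pos w by (simp add: gs)
    then have F0: "F (fst w) = 0" using w by simp
    have "g (F (fst w)) x = 0" "g (F (fst w)) y = 0" "g (F (fst w)) z = 0" by (simp_all add: F0 gs)
    then have "su2_coord 0 (fst w) = 0" "su2_coord 1 (fst w) = 0" "su2_coord 2 (fst w) = 0"
      using c_pos by (simp_all add: F_def gs m m')
    then have "fst w = 0"
      using su2_eq_matrix[of "fst w"] w(1) su2_matrix_0 by (auto simp: su2_R_def)
    then show "w = 0" using s0 by (simp add: prod_eq_iff)
  next
    fix v assume v: "v \<in> V"
    then have "v - (g v t / c) *\<^sub>R z0 = (v - (g v t / c) *\<^sub>R t) + (g v t / c) *\<^sub>R s"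
      by (simp add: z0_def algebra_simps)
    also have "\<dots> \<in> H" using V_decomp[OF v] s by simp
    finally obtain p q r where "v - (g v t / c) *\<^sub>R z0 = p *\<^sub>R x + q *\<^sub>R y + r *\<^sub>R z"
      unfolding sp in_span_three by blast
    then show "\<exists>w\<in>su2_R. F (fst w) + snd w *\<^sub>R z0 = v"
      by (intro bexI[of _ "(su2_matrix p q r, g v t / c)"]) (auto simp: F_def su2_R_def algebra_simps)
  next
    fix w w' assume "w \<in> su2_R" "w' \<in> su2_R"
    then obtain p q r p' q' r' where AB: "fst w = su2_matrix p q r" "fst w' = su2_matrix p' q' r'"
      unfolding su2_R_def using su2_eq_matrix by (metis mem_Times_iff)
    show "F (fst (su2_R_bracket w w')) + snd (su2_R_bracket w w') *\<^sub>R z0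
        = br (F (fst w) + snd w *\<^sub>R z0) (F (fst w') + snd w' *\<^sub>R z0)"
      using F_H z0 by (simp add: su2_R_bracket_def sum_bracket_def abelian_bracket_def brs bz H_V)
        (simp add: F_def AB commutator_su2_matrix brs b algebra_simps)
  qed
  then show ?thesis by (auto simp: lie_isomorphic_def)
qed

lemma classification:
  "lie_isomorphic (UNIV :: (real^1) set) abelian_bracket V br \<or>
   lie_isomorphic (UNIV :: (real^2) set) abelian_bracket V br \<or>
   lie_isomorphic su2_R su2_R_bracket V br"
  using milnor_frame isomorphic_R1 isomorphic_R2 isomorphic_su2_R by blast

text \<open>The images of the cross-product basis form a triple spanning \<open>H\<close>, so their
  square length is \<open>1 / (4 * c) = 2 * \<mu>\<close>, against -2 for the Killing form. For the
  centre, \<open>t - s\<close> is central and hence a multiple \<open>l\<close> of \<open>z\<close>;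
  \<open>x0\<close> is the preimage of \<open>s\<close>.\<close>

lemma su2_R_isomorphism_metric:
  assumes "lie_isomorphism su2_R su2_R_bracket V br \<phi>"
  defines "\<mu> \<equiv> 1 / (8 * c)" and "\<kappa> \<equiv> killing_form su2 commutator"
  shows "A \<in> su2 \<Longrightarrow> B \<in> su2 \<Longrightarrow> g (\<phi> (A, 0)) (\<phi> (B, 0)) = - \<mu> * \<kappa> A B"
    and "z \<in> V \<Longrightarrow> span {z} = lie_center V br \<Longrightarrow>
      \<exists>l x0. l \<noteq> 0 \<and> x0 \<in> su2 \<and> (\<forall>A\<in>su2. g z (\<phi> (A, 0)) = \<mu> / l * \<kappa> x0 A) \<and>
        g z z = 1 / l\<^sup>2 * (1 / (8 * \<mu>) - \<mu> * \<kappa> x0 x0) \<and> t = l *\<^sub>R z + \<phi> (x0, 0)"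
proof -
  have \<phi>: "linear_between su2_R V \<phi>" "bij_betw \<phi> su2_R V"
    and hom: "\<And>w w'. w \<in> su2_R \<Longrightarrow> w' \<in> su2_R \<Longrightarrow> \<phi> (su2_R_bracket w w') = br (\<phi> w) (\<phi> w')"
    using assms(1) by (auto simp: lie_isomorphism_def)
  have in_W: "(A, k) \<in> su2_R" if "A \<in> su2" for A k using that by (simp add: su2_R_def)
  have add: "\<phi> (u + v) = \<phi> u + \<phi> v" if "u \<in> su2_R" "v \<in> su2_R" for u v
    using \<phi>(1) that by (auto simp: linear_between_def)
  have scl: "\<phi> (k *\<^sub>R u) = k *\<^sub>R \<phi> u" if "u \<in> su2_R" for u k
    using \<phi>(1) that by (auto simp: linear_between_def)
  have in_V: "\<phi> u \<in> V" if "u \<in> su2_R" for u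
    using \<phi>(1) that by (auto simp: linear_between_def)
  have S0: "0 \<in> su2" using subspace_su2 by (rule subspace_0)
  define x y z' w where "x = \<phi> (su2_matrix 1 0 0, 0)" and "y = \<phi> (su2_matrix 0 1 0, 0)"
    and "z' = \<phi> (su2_matrix 0 0 1, 0)" and "w = \<phi> (0, 1)"
  have \<iota>: "\<phi> (A, k) = su2_coord 0 A *\<^sub>R x + su2_coord 1 A *\<^sub>R y + su2_coord 2 A *\<^sub>R z' + k *\<^sub>R w"
    if "A \<in> su2" for A k
  proof -
    obtain p q r where A: "A = su2_matrix p q r" using su2_eq_matrix \<open>A \<in> su2\<close> by blast
    have "(A, k) = p *\<^sub>R (su2_matrix 1 0 0, 0) + q *\<^sub>R (su2_matrix 0 1 0, 0)
        + r *\<^sub>R (su2_matrix 0 0 1, 0) + k *\<^sub>R (0, 1)"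
      by (simp add: A su2_matrix_add su2_matrix_scale)
    also have "\<phi> \<dots> = p *\<^sub>R x + q *\<^sub>R y + r *\<^sub>R z' + k *\<^sub>R w"
      by (simp only: x_def y_def z'_def w_def)
        (simp add: add[symmetric] scl[symmetric] in_W S0 su2_matrix_scale su2_matrix_add)
    finally show ?thesis by (simp add: A)
  qed
  have tr: "su2_triple x y z'"
    by (simp add: su2_triple_def x_def y_def z'_def in_W flip: hom)
      (simp add: su2_R_bracket_def sum_bracket_def abelian_bracket_def commutator_su2_matrix)
  have nz: "x \<noteq> 0"
  proof
    assume "x = 0"
    moreover have "\<phi> (0, 0) = 0" using \<iota>[OF S0, of 0] by (simp add: linear_0[OF linear_su2_coord])
    ultimately have "(su2_matrix 1 0 0, 0 :: real) = (0, 0)"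
      using \<phi>(2) in_W S0 unfolding bij_betw_def x_def by (metis inj_onD su2_matrix_in)
    then have "su2_coord 0 (su2_matrix 1 0 0) = su2_coord 0 0" by simp
    then show False by (simp add: linear_0[OF linear_su2_coord])
  qed
  have in_H: "x \<in> H" "y \<in> H" "z' \<in> H" using su2_triple_in_H[OF tr] by auto
  have expand_V: "\<exists>p q r k. v = p *\<^sub>R x + q *\<^sub>R y + r *\<^sub>R z' + k *\<^sub>R w" if "v \<in> V" for v
  proof -
    have "v \<in> \<phi> ` su2_R" using \<phi>(2) that by (simp add: bij_betw_def)
    then show ?thesis using \<iota> by (fastforce simp: su2_R_def)
  qed
  have "t \<notin> H" using c_pos by (simp add: H_def c_def)
  \<comment> \<open>Otherwise all generators of \<open>V\<close> would lie in \<open>H\<close>, and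
    so would \<open>t\<close>.\<close>
  have wH: "w \<notin> H"
  proof
    assume "w \<in> H"
    then have "p *\<^sub>R x + q *\<^sub>R y + r *\<^sub>R z' + k *\<^sub>R w \<in> H" for p q r k using in_H by simp
    then have "t \<in> H" using expand_V[OF t_in] by metis
    with \<open>t \<notin> H\<close> show False by simp
  qed
  have sp: "H = span {x, y, z'}"
  proof
    show "span {x, y, z'} \<subseteq> H" using in_H by (intro span_minimal subspace_H) auto
    show "H \<subseteq> span {x, y, z'}"
    proof
      fix h assume h: "h \<in> H"
      then obtain p q r k where e: "h = p *\<^sub>R x + q *\<^sub>R y + r *\<^sub>R z' + k *\<^sub>R w"
        using expand_V H_V by blast
      have "k = 0"
      proof (rule ccontr)
        assume "k \<noteq> 0"
        have "(1 / k) *\<^sub>R (h - (p *\<^sub>R x + q *\<^sub>R y + r *\<^sub>R z')) \<in> H" using h in_H by auto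
        also have "h - (p *\<^sub>R x + q *\<^sub>R y + r *\<^sub>R z') = k *\<^sub>R w" by (simp add: e)
        finally show False using wH \<open>k \<noteq> 0\<close> by simp
      qed
      then show "h \<in> span {x, y, z'}" unfolding in_span_three using e by auto
    qed
  qed
  note m = su2_triple_metric[OF tr nz sp]
  have m': "g y x = 0" "g z' y = 0" "g x z' = 0" using m g_sym by auto
  show metric: "g (\<phi> (A, 0)) (\<phi> (B, 0)) = - \<mu> * \<kappa> A B" if "A \<in> su2" "B \<in> su2" for A B
    using that c_pos by (simp add: \<iota> gs m m' \<kappa>_def killing_form_su2 \<mu>_def field_simps)
  have \<iota>H: "\<phi> (A, 0) \<in> H" if "A \<in> su2" for A using that in_H by (simp add: \<iota>)
  show "\<exists>l x0. l \<noteq> 0 \<and> x0 \<in> su2 \<and> (\<forall>A\<in>su2. g z (\<phi> (A, 0)) = \<mu> / l * \<kappa> x0 A) \<and>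
        g z z = 1 / l\<^sup>2 * (1 / (8 * \<mu>) - \<mu> * \<kappa> x0 x0) \<and> t = l *\<^sub>R z + \<phi> (x0, 0)"
    if z: "z \<in> V" "span {z} = lie_center V br"
  proof -
    obtain s where s: "s \<in> H" and cen: "\<And>v. v \<in> V \<Longrightarrow> br (t - s) v = 0"
      using ad_t_inner[OF tr nz sp] by blast
    have "t - s \<in> span {z}" using cen s by (simp add: z(2) lie_center_def H_V)
    then obtain l where l: "t - s = l *\<^sub>R z" by (auto simp: span_singleton)
    have l0: "l \<noteq> 0" using l s \<open>t \<notin> H\<close> by auto
    obtain p q r where "s = p *\<^sub>R x + q *\<^sub>R y + r *\<^sub>R z'" using s unfolding sp in_span_three by blast
    then have x0: "s = \<phi> (su2_matrix p q r, 0)" by (simp add: \<iota>)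
    define x0 where "x0 = su2_matrix p q r"
    have x0: "x0 \<in> su2" "s = \<phi> (x0, 0)" using x0 by (simp_all add: x0_def)
    have ze: "z = (1 / l) *\<^sub>R (t - s)" using l0 by (simp add: l)
    have tH: "g t h = 0" "g h t = 0" if "h \<in> H" for h using that g_sym by (auto simp: H_def)
    have "g z (\<phi> (A, 0)) = \<mu> / l * \<kappa> x0 A" if "A \<in> su2" for A
      using metric[OF x0(1) that] by (simp add: ze gs tH \<iota>H[OF that] flip: x0(2))
    moreover have "g z z = 1 / l\<^sup>2 * (1 / (8 * \<mu>) - \<mu> * \<kappa> x0 x0)"
    proof -
      \<comment> \<open>Here \<open>t\<close> is orthogonal to \<open>s\<close>, so the square
        length of \<open>t - s\<close> is \<open>c + g s s\<close>; moreover
        \<open>c = 1 / (8 * \<mu>)\<close>.\<close>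
      have "g z z = (c + g s s) / l\<^sup>2"
        using l0 by (simp add: ze gs tH s power2_eq_square add_divide_distrib flip: c_def)
      also have "g s s = - \<mu> * \<kappa> x0 x0" using metric[OF x0(1,1)] by (simp add: x0(2))
      finally show ?thesis by (simp add: \<mu>_def)
    qed
    moreover have "t = l *\<^sub>R z + \<phi> (x0, 0)" by (simp flip: l x0(2))
    ultimately show ?thesis using l0 x0(1) by blast
  qed
qed

end

section \<open>From data on a subspace to globally bilinear data\<close>

lemma linear_projection_exists:
  fixes V :: "'a::real_vector set"
  assumes "subspace V"
  obtains pr :: "'a \<Rightarrow> 'a" where "linear pr" "\<And>x. pr x \<in> V" "\<And>x. x \<in> V \<Longrightarrow> pr x = x"
  using linear_exists_left_inverse_on[OF linear_ident assms] by (auto simp: image_subset_iff)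

lemma bilinear_extension:
  assumes h: "bilinear_between V W h" and pr: "linear pr" "\<And>x. pr x \<in> V"
  shows "bilinear (\<lambda>x y. h (pr x) (pr y))"
  using h pr(2) unfolding bilinear_def bilinear_between_def linear_between_def
  by (auto intro!: linearI simp: linear_add[OF pr(1)] linear_cmul[OF pr(1)])

context orthonormal_frame
begin

text \<open>Existence from the frame, uniqueness from definiteness; this justifies the definite
  descriptions in \<open>sharp\<close> and \<open>levi_civita\<close>.\<close>

lemma riesz:
  assumes "linear_between V UNIV f"
  shows "\<exists>!w. w \<in> V \<and> (\<forall>z\<in>V. g w z = f z)"
proof (rule ex_ex1I)
  let ?w = "\<Sum>i<n. f (e i) *\<^sub>R e i"
  have "g ?w z = f z" if "z \<in> V" for z
  proof -
    have "f z = f (\<Sum>i<n. g z (e i) *\<^sub>R e i)" using expand[OF that] by simp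
    also have "\<dots> = (\<Sum>i<n. g z (e i) *\<^sub>R f (e i))"
      by (rule linear_between_sum[OF V assms]) (auto intro: e_in)
    finally show ?thesis by (simp add: bilinear_lsum[OF g_bilinear] gs g_sym[of z] mult.commute)
  qed
  moreover have "?w \<in> V" by (intro subspace_sum subspace_scale V e_in) simp
  ultimately show "\<exists>w. w \<in> V \<and> (\<forall>z\<in>V. g w z = f z)" by blast
qed (auto intro: g_eqI)

lemma sharp_props:
  assumes "linear_between V UNIV \<theta>"
  shows "sharp V g \<theta> \<in> V" "z \<in> V \<Longrightarrow> g (sharp V g \<theta>) z = \<theta> z"
  using theI'[OF riesz[OF assms]] by (auto simp: sharp_def)

lemma levi_civita_props:
  assumes "bilinear_between V V br" "x \<in> V" "y \<in> V"
  shows "levi_civita V br g x y \<in> V"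
    "z \<in> V \<Longrightarrow> g (levi_civita V br g x y) z = (g (br x y) z - g (br x z) y - g (br y z) x) / 2"
proof -
  have "linear_between V UNIV (\<lambda>z. (1/2) * (g (br x y) z - g (br x z) y - g (br y z) x))"
    using assms by (simp add: bilinear_between_def linear_between_def gs algebra_simps add_divide_distrib diff_divide_distrib)
  from theI'[OF riesz[OF this]]
  show "levi_civita V br g x y \<in> V"
    "z \<in> V \<Longrightarrow> g (levi_civita V br g x y) z = (g (br x y) z - g (br x z) y - g (br y z) x) / 2"
    by (auto simp: levi_civita_def)
qed

end

text \<open>The connection, the bracket and the metric are extended from \<open>V\<close> to the ambient space by
  precomposing with a linear projection, which makes them globally bilinear.\<close>

lemma flat_similarity_of_conformally_flat_lcp:
  fixes V :: "'a::real_vector set"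
  assumes lie: "lie_algebra V br" and uni: "unimodular V br" and lcp: "conformally_flat_lcp V br g \<theta>"
  obtains g' n e D t br' where "flat_similarity V g' n e D t br'"
    "\<And>x y. x \<in> V \<Longrightarrow> y \<in> V \<Longrightarrow> g' x y = g x y"
    "\<And>x y. x \<in> V \<Longrightarrow> y \<in> V \<Longrightarrow> br' x y = br x y"
    "\<And>x. x \<in> V \<Longrightarrow> g' t x = \<theta> x"
proof -
  obtain B where V: "subspace V" and B: "finite B" "span B = V" and br_bil: "bilinear_between V V br"
    and alt: "\<And>x. x \<in> V \<Longrightarrow> br x x = 0"
    using lie by (auto simp: lie_algebra_def)
  have ip: "inner_product_on V g" and th: "linear_between V UNIV \<theta>" "\<exists>x\<in>V. \<theta> x \<noteq> 0"
    and closed: "\<And>x. x \<in> derived_algebra V br \<Longrightarrow> \<theta> x = 0"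
    and rep: "lie_representation V br V (weyl_connection V br g \<theta>)"
    using lcp by (auto simp: conformally_flat_lcp_def lcp_structure_def nonzero_one_form_def
        closed_form_def weyl_flat_def)
  obtain pr where pr: "linear pr" "\<And>x. pr x \<in> V" "\<And>x. x \<in> V \<Longrightarrow> pr x = x"
    using linear_projection_exists[OF V] by blast
  define g' where "g' x y = g (pr x) (pr y)" for x y
  define br' where "br' x y = br (pr x) (pr y)" for x y
  define D where "D x y = weyl_connection V br g \<theta> (pr x) (pr y)" for x y
  have g': "g' x y = g x y" and br': "br' x y = br x y"
    if "x \<in> V" "y \<in> V" for x y
    using that by (simp_all add: g'_def br'_def pr)
  have g'_bil: "bilinear g'"
    using ip unfolding g'_def[abs_def] inner_product_on_def
    by (intro bilinear_extension[OF _ pr(1,2)]) auto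
  have g'_sym: "g' x y = g' y x" for x y
    using ip pr(2) by (simp add: g'_def inner_product_on_def)
  have g'_pos: "g' x x > 0" if "x \<in> V" "x \<noteq> 0" for x
    using ip that by (simp add: g' inner_product_on_def)
  obtain n :: nat and e where frame: "orthonormal_frame V g' n e"
  proof -
    obtain n :: nat and e where "\<And>i. i < n \<Longrightarrow> e i \<in> V"
      "\<And>i j. i < n \<Longrightarrow> j < n \<Longrightarrow> g' (e i) (e j) = (if i = j then 1 else 0)"
      "\<And>x. x \<in> V \<Longrightarrow> x = (\<Sum>i<n. g' x (e i) *\<^sub>R e i)"
      using orthonormal_basis_exists[OF B(1) g'_bil g'_sym] g'_pos unfolding B(2) by metis
    then have "orthonormal_frame V g' n e"
      using V g'_bil g'_sym g'_pos by unfold_locales auto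
    then show ?thesis by (rule that)
  qed
  interpret orthonormal_frame V g' n e by (rule frame)
  define t where "t = sharp V g \<theta>"
  have br_V: "br x y \<in> V" if "x \<in> V" "y \<in> V" for x y
    using br_bil that by (auto simp: bilinear_between_def linear_between_def)
  have br_anti: "br y x = - br x y" if "x \<in> V" "y \<in> V" for x y
  proof -
    have "br (x + y) (x + y) = br x x + br x y + (br y x + br y y)"
      using br_bil that by (simp add: bilinear_between_def linear_between_def)
    then show ?thesis using alt that by (simp add: add_eq_0_iff)
  qed
  have t: "t \<in> V" "g' t z = \<theta> z" if "z \<in> V" for z
  proof -
    \<comment> \<open>The description tests only vectors of \<open>V\<close>, where the two metrics
      agree.\<close>
    have "sharp V g \<theta> = sharp V g' \<theta>"
      unfolding sharp_def by (rule arg_cong[of _ _ The]) (auto simp: g')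
    then show "t \<in> V" "g' t z = \<theta> z" using sharp_props[OF th(1)] that by (auto simp: t_def)
  qed
  have tV: "t \<in> V" using t(1) pr(2) by blast
  define L where "L = levi_civita V br g"
  have L: "L x y \<in> V" "z \<in> V \<Longrightarrow> g' (L x y) z = (g' (br x y) z - g' (br x z) y - g' (br y z) x) / 2"
    if "x \<in> V" "y \<in> V" for x y z
  proof -
    have "L x y = levi_civita V br g' x y"
      unfolding levi_civita_def L_def by (rule arg_cong[of _ _ The]) (use that in \<open>auto simp: g' br_V\<close>)
    then show "L x y \<in> V" "z \<in> V \<Longrightarrow> g' (L x y) z = (g' (br x y) z - g' (br x z) y - g' (br y z) x) / 2"
      using levi_civita_props[OF br_bil that] by auto
  qed
  have W: "weyl_connection V br g \<theta> x y = L x y + g' t x *\<^sub>R y + g' t y *\<^sub>R x - g' x y *\<^sub>R t"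
    if "x \<in> V" "y \<in> V" for x y
    using that by (simp add: weyl_connection_def L_def t(2) g'[OF that] flip: t_def)
  have W_V: "weyl_connection V br g \<theta> x y \<in> V" if "x \<in> V" "y \<in> V" for x y
    using that L tV by (simp add: W)
  have torsion: "L x y - L y x = br x y" if "x \<in> V" "y \<in> V" for x y
  proof (rule g_eqI)
    fix z assume "z \<in> V"
    then show "g' (L x y - L y x) z = g' (br x y) z"
      using that br_anti[OF that] by (simp add: gs L field_simps)
  qed (use that L br_V in auto)
  have compat: "g' (L x y) z + g' y (L x z) = 0" if "x \<in> V" "y \<in> V" "z \<in> V" for x y z
    using that br_anti[of y z] by (simp add: L g_sym[of y "L x z"] gs) (simp add: g_sym field_simps)
  \<comment> \<open>Bilinearity of the connection is read off the representation on
    \<open>U = V\<close>.\<close>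
  have rep': "linear_between V V (weyl_connection V br g \<theta> x)"
    "linear_between V V (\<lambda>y. weyl_connection V br g \<theta> y x)" if "x \<in> V" for x
    using rep that by (auto simp: lie_representation_def)
  have sim: "flat_similarity V g' n e D t br'"
  proof (unfold_locales, goal_cases)
    case 1
    show ?case unfolding D_def[abs_def]
      using rep' by (intro bilinear_extension[OF _ pr(1,2), of V]) (auto simp: bilinear_between_def)
  next
    case (2 x y)
    show ?case by (simp add: D_def W_V pr)
  next
    case 3
    show ?case by (rule tV)
  next
    case 4
    show ?case using th(2) t(2) by (auto simp: gs)
  next
    case (5 x y)
    show ?case
      using torsion[of "pr x" "pr y"] pr(2)
      by (simp add: D_def br'_def W g_sym[of "pr y"])
  next
    case (6 x y u)
    have "weyl_connection V br g \<theta> (br (pr x) (pr y)) (pr u)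
      = weyl_connection V br g \<theta> (pr x) (weyl_connection V br g \<theta> (pr y) (pr u))
        - weyl_connection V br g \<theta> (pr y) (weyl_connection V br g \<theta> (pr x) (pr u))"
      using rep pr(2) by (simp add: lie_representation_def)
    then show ?case by (simp add: D_def br'_def pr br_V W_V)
  next
    case (7 x y z)
    \<comment> \<open>The projection is idempotent, so \<open>g'\<close> does not see it; this lets
      the identity be checked on \<open>V\<close>.\<close>
    have g_pr: "g' (pr u) v = g' u v" "g' v (pr u) = g' v u" for u v by (simp_all add: g'_def pr)
    have "g' (D x y) z + g' y (D x z) = g' (D x y) (pr z) + g' (pr y) (D x z)" by (simp add: g_pr)
    also have "\<dots> = 2 * g' t (pr x) * g' (pr y) (pr z)"
      using compat[of "pr x" "pr y" "pr z"] pr(2) g_sym[of "pr y" t] g_sym[of "pr y" "pr x"]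
      by (simp add: D_def W gs algebra_simps g_sym[of _ t])
    finally show ?case by (simp add: g_pr)
  next
    case (8 x y)
    have "br (pr x) (pr y) \<in> derived_algebra V br"
      using pr(2) by (auto simp: derived_algebra_def intro!: span_base)
    then show ?case using closed t br_V pr(2) by (simp add: br'_def)
  next
    case (9 x)
    have "endo_trace V (br x) = (\<Sum>i<n. g' (br x (e i)) (e i))"
      using 9 br_bil e_in expand
      by (intro endo_trace_coordinates[OF V B]) (auto simp: bilinear_between_def linear_between_def gs)
    also have "\<dots> = tr (br' x)" using 9 by (simp add: tr_def br' e_in)
    finally show ?case using uni 9 by (simp add: unimodular_def)
  qed
  show ?thesis by (rule that[OF sim g' br' t(2)])
qed

lemma lie_center_cong:
  "(\<And>x y. x \<in> V \<Longrightarrow> y \<in> V \<Longrightarrow> br x y = br' x y) \<Longrightarrow> lie_center V br = lie_center V br'"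
  by (auto simp: lie_center_def)

text \<open>No identification of \<open>V\<close> with a model is canonical, so the explicit
  formulas are proved for every isomorphism \<open>\<phi>\<close> and every generator
  \<open>z\<close> of the centre.\<close>

theorem proposition3p7:
  fixes V :: "'a::real_vector set"
    and br :: "'a \<Rightarrow> 'a \<Rightarrow> 'a"
    and g :: "'a \<Rightarrow> 'a \<Rightarrow> real"
    and \<theta> :: "'a \<Rightarrow> real"
  assumes "lie_algebra V br"
    and "unimodular V br"
    and "conformally_flat_lcp V br g \<theta>"
  shows
    "(lie_isomorphic (UNIV :: (real^1) set) abelian_bracket V br \<or>
      lie_isomorphic (UNIV :: (real^2) set) abelian_bracket V br \<or>
      lie_isomorphic su2_R su2_R_bracket V br) \<and>
     (\<forall>\<phi> :: real^1 \<Rightarrow> 'a. lie_isomorphism UNIV abelian_bracket V br \<phi> \<longrightarrow>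
        inner_product_on UNIV (\<lambda>x y. g (\<phi> x) (\<phi> y)) \<and> nonzero_one_form UNIV (\<lambda>x. \<theta> (\<phi> x))) \<and>
     (\<forall>\<phi> :: real^2 \<Rightarrow> 'a. lie_isomorphism UNIV abelian_bracket V br \<phi> \<longrightarrow>
        inner_product_on UNIV (\<lambda>x y. g (\<phi> x) (\<phi> y)) \<and> nonzero_one_form UNIV (\<lambda>x. \<theta> (\<phi> x))) \<and>
     (\<forall>\<phi>. lie_isomorphism su2_R su2_R_bracket V br \<phi> \<longrightarrow>
        (let \<iota> = (\<lambda>x. \<phi> (x, 0)); \<kappa> = killing_form su2 commutator in
          (\<forall>z\<in>V. span {z} = lie_center V br \<longrightarrow>
            (\<exists>\<mu>>0. \<exists>l. l \<noteq> 0 \<and> (\<exists>x0\<in>su2.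
              (\<forall>x\<in>su2. \<forall>y\<in>su2. g (\<iota> x) (\<iota> y) = - \<mu> * \<kappa> x y) \<and>
              (\<forall>x\<in>su2. g z (\<iota> x) = \<mu> / l * \<kappa> x0 x) \<and>
              g z z = 1 / l^2 * (1 / (8 * \<mu>) - \<mu> * \<kappa> x0 x0) \<and>
              (\<forall>y\<in>V. \<theta> y = g (l *\<^sub>R z + \<iota> x0) y)))) \<and>
          (\<exists>c. \<forall>x\<in>su2. \<forall>y\<in>su2. g (\<iota> x) (\<iota> y) = c * \<kappa> x y)))"
proof -
  obtain g' n e D t br' where "flat_similarity V g' n e D t br'"
    and g': "\<And>x y. x \<in> V \<Longrightarrow> y \<in> V \<Longrightarrow> g' x y = g x y"
    and br': "\<And>x y. x \<in> V \<Longrightarrow> y \<in> V \<Longrightarrow> br' x y = br x y"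
    and t: "\<And>x. x \<in> V \<Longrightarrow> g' t x = \<theta> x"
    using flat_similarity_of_conformally_flat_lcp[OF assms] by blast
  interpret flat_similarity V g' n e D t br' by fact
  have ip: "inner_product_on V g" and form: "nonzero_one_form V \<theta>"
    using assms(3) by (auto simp: conformally_flat_lcp_def lcp_structure_def)
  have center: "lie_center V br = lie_center V br'"
    by (rule lie_center_cong) (simp add: br')
  have iso: "lie_isomorphism W brW V br \<phi> \<longleftrightarrow> lie_isomorphism W brW V br' \<phi>"
    for W :: "'b::real_vector set" and brW \<phi>
    by (rule lie_isomorphism_cong) (simp add: br')
  have pull: "inner_product_on W (\<lambda>x y. g (\<phi> x) (\<phi> y)) \<and> nonzero_one_form W (\<lambda>x. \<theta> (\<phi> x))"
    if "lie_isomorphism W brW V br \<phi>" "subspace W" for W :: "'b::real_vector set" and brW \<phi>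
    using that inner_product_on_pullback[OF _ _ that(2) ip] nonzero_one_form_pullback[OF _ _ form]
    by (auto simp: lie_isomorphism_def bij_betw_def)
  have models: "lie_isomorphic (UNIV :: (real^1) set) abelian_bracket V br \<or>
      lie_isomorphic (UNIV :: (real^2) set) abelian_bracket V br \<or>
      lie_isomorphic su2_R su2_R_bracket V br"
    using classification unfolding lie_isomorphic_def iso .
  \<comment> \<open>Independent of \<open>\<phi>\<close> and \<open>z\<close>: it depends only on
    the length of the dual vector of \<open>\<theta>\<close>.\<close>
  define \<mu> where "\<mu> = 1 / (8 * c)"
  have \<mu>: "\<mu> > 0" using c_pos by (simp add: \<mu>_def)
  let ?\<kappa> = "killing_form su2 commutator"
  have metric: "g (\<phi> (x, 0)) (\<phi> (y, 0)) = - \<mu> * ?\<kappa> x y"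
    if "lie_isomorphism su2_R su2_R_bracket V br \<phi>" "x \<in> su2" "y \<in> su2" for \<phi> x y
    using su2_R_isomorphism_metric(1)[OF that(1)[unfolded iso] that(2,3)] that
    by (auto simp: \<mu>_def g' lie_isomorphism_def linear_between_def su2_R_def)
  have on_center: "\<exists>\<mu>>0. \<exists>l. l \<noteq> 0 \<and> (\<exists>x0\<in>su2.
      (\<forall>x\<in>su2. \<forall>y\<in>su2. g (\<phi> (x, 0)) (\<phi> (y, 0)) = - \<mu> * ?\<kappa> x y) \<and>
      (\<forall>x\<in>su2. g z (\<phi> (x, 0)) = \<mu> / l * ?\<kappa> x0 x) \<and>
      g z z = 1 / l^2 * (1 / (8 * \<mu>) - \<mu> * ?\<kappa> x0 x0) \<and>
      (\<forall>y\<in>V. \<theta> y = g (l *\<^sub>R z + \<phi> (x0, 0)) y))"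
    if \<phi>: "lie_isomorphism su2_R su2_R_bracket V br \<phi>" and z: "z \<in> V" "span {z} = lie_center V br" for \<phi> z
  proof -
    have in_V: "\<phi> (x, 0) \<in> V" if "x \<in> su2" for x
      using \<phi> that by (auto simp: lie_isomorphism_def linear_between_def su2_R_def)
    obtain l x0 where *: "l \<noteq> 0" "x0 \<in> su2" "\<And>A. A \<in> su2 \<Longrightarrow> g' z (\<phi> (A, 0)) = \<mu> / l * ?\<kappa> x0 A"
      "g' z z = 1 / l\<^sup>2 * (1 / (8 * \<mu>) - \<mu> * ?\<kappa> x0 x0)" "t = l *\<^sub>R z + \<phi> (x0, 0)"
      using su2_R_isomorphism_metric(2)[OF \<phi>[unfolded iso] z(1) z(2)[unfolded center]]
      unfolding \<mu>_def by blast
    have "\<theta> y = g (l *\<^sub>R z + \<phi> (x0, 0)) y" if "y \<in> V" for y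
      using t[OF that] g'[OF t_in that] by (simp flip: *(5))
    then show ?thesis
      using \<mu> *(1-4) metric[OF \<phi>] z(1) in_V
      by (intro exI[of _ \<mu>] conjI exI[of _ l] bexI[of _ x0]) (auto simp: g')
  qed
  have multiple: "\<exists>c. \<forall>x\<in>su2. \<forall>y\<in>su2. g (\<phi> (x, 0)) (\<phi> (y, 0)) = c * ?\<kappa> x y"
    if "lie_isomorphism su2_R su2_R_bracket V br \<phi>" for \<phi>
    using metric[OF that] by blast
  show ?thesis
    unfolding Let_def
    by (intro conjI allI impI ballI models on_center multiple
        pull[OF _ subspace_UNIV, THEN conjunct1] pull[OF _ subspace_UNIV, THEN conjunct2])
qed

end
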